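(* Let $K\subset\mathbb R^2$ be a simple polygon with $\operatorname{aco}K>-\pi$. Then for every point $x\in\mathbb R^2\setminus K$ there exists an angular region $A$ with apex $x$ such that $\angle A=\pi+\operatorname{aco}K$ and $A\cap K=\emptyset$.
   Context: A polyline is a sequence of points $v_1,\dots,v_n\in\mathbb R^2$ (vertices), with $v_i\ne v_{i+1}$, together with the segments $v_1v_2,\dots,v_{n-1}v_n$ (edges). Its shift sequence is $v_2-v_1,\dots,v_n-v_{n-1}$. A polyline $v_1\dots v_{n+1}$ is closed if $v_1=v_{n+1}$; then its vertices and shifts are indexed modulo $n$. A polyline is simple if it has no self-intersections: consecutive edges meet in exactly one point (the common vertex), and non-consecutive edges are disjoint (for a closed polyline the first vertex is allowed to equal the last one, so the last and first edges count as consecutive). A simple polygon is a compact region $K\subset\mathbb R^2$ whose boundary $\partial K$ is a closed simple polyline, i.e. $K$ is the union of a closed simple polyline and the bounded component of its complement. Two nonzero vectors $v,w$ are opposite if $v=\alpha w$ with $\alpha<0$. For nonzero non-opposite vectors, $\angle(v,w)\in(-\pi,\pi)$ is the signed angle from $v$ to $w$: it has absolute value equal to the usual angle between $v$ and $w$, and it has the sign of $[v,w]=v_xw_y-v_yw_x$. A polyline is non-reverse if no two consecutive elements of its shift sequence are opposite (every simple polyline is non-reverse). The rotation of a non-reverse (open) polyline with shift sequence $(s_1,\dots,s_n)$ is $\operatorname{rot}=\sum_{i=1}^{n-1}\angle(s_i,s_{i+1})$ (equal to $0$ if there are only two vertices); the rotation of a closed polyline with shifts $s_1,\dots,s_n$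 is $\sum_{i=1}^{n}\angle(s_i,s_{i+1})$ with indices modulo $n$. For a simple polygon $K$, orient $P=\partial K$ so that $\operatorname{rot}P=2\pi$ (counterclockwise). The angular convexity of $K$ is $$\operatorname{aco}K=\min_{L\subseteq P}\operatorname{rot}L,$$ the minimum being over simple polylines $L$ contained in $P$ and oriented along $P$ (that is, oriented sub-arcs of $P$, whose endpoints may be any points of $P$). One always has $\operatorname{aco}K\le 0$. An angular region $A$ with apex $x$ is the convex hull of two (closed) rays $r_1,r_2$ with common apex $x$, and its angular measure is $\angle A=|\angle(r_1,r_2)|$, the angle between the directions of the rays. An angular region of measure $\pi$ with apex $x$ means a closed half-plane with $x$ on its boundary line. *)

theory Defs
  imports "HOL-Analysis.Analysis"
begin

text \<open>
  The plane is modelled by the Euclidean space \<^typ>\<open>complex\<close>, the type over which the library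
  states the Jordan curve theorem. Only its real inner product space structure is used.
\<close>

definition cross :: "complex \<Rightarrow> complex \<Rightarrow> real" where
  "cross v w = Re v * Im w - Im v * Re w"

definition opposite :: "complex \<Rightarrow> complex \<Rightarrow> bool" where
  "opposite v w \<longleftrightarrow> v \<noteq> 0 \<and> w \<noteq> 0 \<and> (\<exists>\<alpha><0. v = \<alpha> *\<^sub>R w)"

text \<open>
  Only meaningful for nonzero non-opposite vectors: if the cross product vanishes, then such vectors
  are positively proportional, so the unsigned angle is \<open>0\<close> as well.
\<close>

definition signed_angle :: "complex \<Rightarrow> complex \<Rightarrow> real" where
  "signed_angle v w = sgn (cross v w) * arccos ((v \<bullet> w) / (norm v * norm w))"

text \<open>
  A polyline is the list of its vertices. Lists with a single vertex are excluded: they have no edges.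
\<close>

definition polyline :: "complex list \<Rightarrow> bool" where
  "polyline vs \<longleftrightarrow> 2 \<le> length vs \<and> distinct_adj vs"

definition edge :: "complex list \<Rightarrow> nat \<Rightarrow> complex set" where
  "edge vs i = closed_segment (vs ! i) (vs ! Suc i)"

definition polyline_set :: "complex list \<Rightarrow> complex set" where
  "polyline_set vs = (\<Union>i<length vs - 1. edge vs i)"

definition shifts :: "complex list \<Rightarrow> complex list" where
  "shifts vs = map (\<lambda>i. vs ! Suc i - vs ! i) [0..<length vs - 1]"

definition simple_polyline :: "complex list \<Rightarrow> bool" where
  "simple_polyline vs \<longleftrightarrow> polyline vs \<and>
     (\<forall>i. i + 2 < length vs \<longrightarrow> edge vs i \<inter> edge vs (Suc i) = {vs ! Suc i}) \<and>
     (\<forall>i j. Suc i < j \<and> Suc j < length vs \<longrightarrow> edge vs i \<inter> edge vs j = {})"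

text \<open>
  A closed polyline repeats its first vertex at the end of the list, so a list of length \<open>n + 1\<close>
  has \<open>n\<close> edges, whose indices are taken modulo \<open>n\<close>.
\<close>

definition closed_polyline :: "complex list \<Rightarrow> bool" where
  "closed_polyline vs \<longleftrightarrow> polyline vs \<and> hd vs = last vs"

definition simple_closed_polyline :: "complex list \<Rightarrow> bool" where
  "simple_closed_polyline vs \<longleftrightarrow> closed_polyline vs \<and>
     (let n = length vs - 1 in
       (\<forall>i<n. edge vs i \<inter> edge vs (Suc i mod n) = {vs ! Suc i}) \<and>
       (\<forall>i<n. \<forall>j<n. i \<noteq> j \<and> j \<noteq> Suc i mod n \<and> i \<noteq> Suc j mod n \<longrightarrow>
          edge vs i \<inter> edge vs j = {}))"

definition rot :: "complex list \<Rightarrow> real" where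
  "rot vs = (let s = shifts vs in
     \<Sum>i<length s - 1. signed_angle (s ! i) (s ! Suc i))"

definition closed_rot :: "complex list \<Rightarrow> real" where
  "closed_rot vs = (let s = shifts vs; n = length s in
     \<Sum>i<n. signed_angle (s ! i) (s ! (Suc i mod n)))"

definition bounds_polygon :: "complex list \<Rightarrow> complex set \<Rightarrow> bool" where
  "bounds_polygon vs K \<longleftrightarrow> simple_closed_polyline vs \<and>
     (\<exists>C \<in> components (- polyline_set vs). bounded C \<and> K = polyline_set vs \<union> C)"

definition simple_polygon :: "complex set \<Rightarrow> bool" where
  "simple_polygon K \<longleftrightarrow> (\<exists>vs. bounds_polygon vs K)"

text \<open>
  The vertices of a sub-arc \<open>L\<close> need not be vertices of \<open>P\<close>, and an edge of \<open>L\<close> may run over several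
  collinear edges of \<open>P\<close>. Hence the orientations are compared on every pair of edges
  that share more than one point.
\<close>

definition oriented_along :: "complex list \<Rightarrow> complex list \<Rightarrow> bool" where
  "oriented_along L P \<longleftrightarrow>
     (\<forall>i j. Suc i < length L \<and> Suc j < length P \<and>
        (\<exists>p q. p \<noteq> q \<and> {p, q} \<subseteq> edge L i \<inter> edge P j) \<longrightarrow>
        (\<exists>\<alpha>>0. L ! Suc i - L ! i = \<alpha> *\<^sub>R (P ! Suc j - P ! j)))"

text \<open>
  The minimum is over a finite set of reals, although there are infinitely many \<open>L\<close>: a nonzero angle
  of \<open>L\<close> occurs at a vertex of \<open>P\<close> and equals the angle of \<open>P\<close> there, and \<open>L\<close> visits each vertex of
  \<open>P\<close> at most once.
\<close>

definition aco_boundary :: "complex list \<Rightarrow> real" where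
  "aco_boundary P = Min {rot L | L.
     simple_polyline L \<and> polyline_set L \<subseteq> polyline_set P \<and> oriented_along L P}"

text \<open>
  The counterclockwise boundary is unique up to the choice of the first vertex and of
  superfluous vertices inside straight sides. Neither affects \<^const>\<open>aco_boundary\<close>.
\<close>

definition aco :: "complex set \<Rightarrow> real" where
  "aco K = aco_boundary (SOME P. bounds_polygon P K \<and> closed_rot P = 2 * pi)"

definition ray :: "complex \<Rightarrow> complex \<Rightarrow> complex set" where
  "ray x v = {x + t *\<^sub>R v | t. 0 \<le> t}"

text \<open>
  \<open>angular_region A x \<theta>\<close>: the set \<open>A\<close> is an angular region with apex \<open>x\<close> and angular measure \<open>\<theta>\<close>.
  The convex hull of two opposite rays is only a line, so half-planes are a separate case.
\<close>

definition angular_region :: "complex set \<Rightarrow> complex \<Rightarrow> real \<Rightarrow> bool" where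
  "angular_region A x \<theta> \<longleftrightarrow>
     (\<exists>v w. v \<noteq> 0 \<and> w \<noteq> 0 \<and> \<not> opposite v w \<and>
        A = convex hull (ray x v \<union> ray x w) \<and> \<theta> = \<bar>signed_angle v w\<bar>) \<or>
     (\<exists>u. u \<noteq> 0 \<and> A = {y. 0 \<le> u \<bullet> (y - x)} \<and> \<theta> = pi)"

end

theory Submission
  imports Defs
begin

text \<open>
  Let \<open>x\<close> lie outside \<open>K\<close>. As the component of \<open>x\<close> in the complement of \<open>\<partial>K\<close> is unbounded, the argument of
  \<open>z - x\<close> has a continuous branch \<open>\<theta>\<close> on \<open>\<partial>K\<close>. If the range of \<open>\<theta>\<close> is shorter than \<open>\<pi> - aco K\<close>, then the
  remaining directions contain an angle of measure \<open>\<pi> + aco K\<close>. Otherwise a shortest sub-arc of \<open>\<partial>K\<close>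
  along which \<open>\<theta>\<close> drops by \<open>\<pi> - aco K\<close> crosses a sector with apex \<open>x\<close> from one side to the other, and
  Hopf's Umlaufsatz shows that its rotation is less than \<open>aco K\<close>, a contradiction.

  Hopf's argument is discrete here: the turning angles of secants \<open>l j - l i\<close> have zero circulation
  around every unit square of index pairs \<open>(i, j)\<close>, since two disjoint edges have a convex
  difference set that misses \<open>0\<close>. The orientation of \<open>\<partial>K\<close> enters only through the existence of a
  counterclockwise boundary.
\<close>

subsection \<open>Signed angles\<close>

text \<open>The constant \<open>pi - aco K\<close> is complementary to the angle sought: if \<theta>
  varies by less than that, the directions left free fill more than
  \<open>2 * pi - (pi - aco K) = pi + aco K\<close>, and the strict inequality keeps even a closed
  angular region off the boundary. Since \<theta> is single valued on the whole closed curve,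
  walking forward from its maximum always leads to its minimum, so it is enough to exclude large
  drops.

  The obstacle is that the rotation of an arc is not a function of the change of \<theta>: edges
  turn differently from the line of sight, and the arc may spiral in between. Hopf's argument trades
  the turning of edges for the variation of the secants at the two end points. Minimality of the arc
  keeps these secants off one ray at each end, so that a fixed branch of \<open>Arg\<close> measures
  the variation. The hypothesis \<open>aco K > - pi\<close> makes the drop less than
  \<open>2 * pi\<close>, so that points of the arc with the same direction from \<open>x\<close>
  have the same \<theta>.\<close>

lemma cross_eq_Im: "cross v w = Im (w * cnj v)"
  by (simp add: cross_def algebra_simps)

lemma cross_rcis: "cross (rcis r a) (rcis s b) = r * s * sin (b - a)"
  by (simp add: cross_def sin_diff algebra_simps)

lemma cross_eq_sin: "cross v w = norm v * norm w * sin (Arg w - Arg v)"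
  by (metis cross_rcis rcis_cmod_Arg)

lemma zero_in_segment_imp_nonpos:
  fixes y z :: complex
  assumes "y \<noteq> 0" "z / y \<in> \<real>\<^sub>\<le>\<^sub>0"
  shows "0 \<in> closed_segment y z"
proof -
  obtain r where r: "r \<le> 0" "z / y = of_real r"
    using assms(2) by (auto elim: nonpos_Reals_cases)
  then have z: "z = r *\<^sub>R y" using assms(1) by (simp add: field_simps scaleR_conv_of_real)
  define t where "t = 1 / (1 - r)"
  have "0 \<le> t" "t \<le> 1" "1 - t + t * r = 0" using r(1) by (auto simp: t_def field_simps)
  moreover have "(1 - t) *\<^sub>R y + t *\<^sub>R z = (1 - t + t * r) *\<^sub>R y" by (simp add: z algebra_simps)
  ultimately show ?thesis unfolding in_segment by (intro exI[of _ t]) auto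
qed

text \<open>Avoiding 0 on the segment says at once that both vectors are nonzero and that they are
  not opposite. This excludes the value \<pi> of \<open>Arg\<close>, where
  \<open>signed_angle\<close> degenerates to 0 because the cross product vanishes.\<close>

lemma signed_angle_eq_Arg:
  assumes "0 \<notin> closed_segment y z"
  shows "signed_angle y z = Arg (z / y)"
proof -
  have nz: "y \<noteq> 0" "z \<noteq> 0" using assms by auto
  have np: "z / y \<notin> \<real>\<^sub>\<le>\<^sub>0" using assms zero_in_segment_imp_nonpos nz by blast
  define \<phi> where "\<phi> = Arg (z / y)"
  have b: "- pi < \<phi>" "\<phi> \<le> pi" by (auto simp: \<phi>_def mpi_less_Arg Arg_le_pi)
  have "\<phi> \<noteq> pi" using np by (auto simp: \<phi>_def Arg_eq_pi complex_nonpos_Reals_iff)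
  then have b': "\<phi> < pi" using b by simp
  have re: "Re (z / y) = norm z / norm y * cos \<phi>" and im: "Im (z / y) = norm z / norm y * sin \<phi>"
    unfolding \<phi>_def norm_divide[symmetric] by (metis Re_rcis rcis_cmod_Arg, metis Im_rcis rcis_cmod_Arg)
  have zy: "z * cnj y = (norm y)\<^sup>2 *\<^sub>R (z / y)"
  proof -
    have "(norm y)\<^sup>2 *\<^sub>R (z / y) = (y * cnj y) * (z / y)"
      by (simp only: scaleR_conv_of_real complex_norm_square)
    then show ?thesis using nz by simp
  qed
  have c: "cross y z = norm z * norm y * sin \<phi>"
    unfolding cross_eq_Im zy using nz by (simp add: im power2_eq_square)
  have "y \<bullet> z = Re (z * cnj y)" by (simp add: inner_complex_def)
  then have d: "y \<bullet> z = norm y * norm z * cos \<phi>"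
    unfolding zy using nz by (simp add: re power2_eq_square)
  have "arccos ((y \<bullet> z) / (norm y * norm z)) = \<bar>\<phi>\<bar>"
  proof -
    have "(y \<bullet> z) / (norm y * norm z) = cos \<bar>\<phi>\<bar>" using nz d by simp
    then show ?thesis using b by (simp only: arccos_cos)
  qed
  moreover have "sgn (cross y z) = sgn \<phi>"
  proof -
    have "sgn (cross y z) = sgn (sin \<phi>)" using nz by (simp add: c sgn_mult)
    also have "\<dots> = sgn \<phi>"
      using b b' sin_gt_zero[of \<phi>] sin_gt_zero[of "-\<phi>"] by (cases "\<phi> = 0"; cases "\<phi> > 0") (auto simp: sgn_if)
    finally show ?thesis .
  qed
  ultimately show ?thesis
    unfolding signed_angle_def \<phi>_def[symmetric] by (simp add: sgn_if abs_if)
qed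

text \<open>A rise of at least \<pi> puts \<open>a\<close> below and \<open>b\<close> above the real
  axis with \<open>cross a b\<close> nonpositive; the segment then meets the cut of
  \<open>Arg\<close>.\<close>

lemma Arg_diff_segment_less_pi:
  assumes "\<And>p. p \<in> closed_segment a b \<Longrightarrow> p \<notin> \<real>\<^sub>\<le>\<^sub>0"
  shows "Arg b - Arg a < pi"
proof (rule ccontr)
  assume "\<not> ?thesis"
  then have d: "Arg b - Arg a \<ge> pi" by simp
  have nz: "a \<notin> \<real>\<^sub>\<le>\<^sub>0" "b \<notin> \<real>\<^sub>\<le>\<^sub>0" using assms by auto
  have "Arg b \<noteq> pi" using nz by (auto simp: Arg_eq_pi complex_nonpos_Reals_iff)
  then have "Arg b < pi" using Arg_le_pi[of b] by simp
  then have "Arg a < 0" "Arg b > 0" using d mpi_less_Arg[of a] by auto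
  then have im: "Im a < 0" "Im b > 0"
    using Arg_neg_iff Arg_lt_pi \<open>Arg b < pi\<close> by auto
  have "sin (Arg b - Arg a) \<le> 0"
    using d \<open>Arg b < pi\<close> mpi_less_Arg[of a] by (intro sin_le_zero) auto
  then have "cross a b \<le> 0" unfolding cross_eq_sin by (simp add: mult_nonneg_nonpos)
  then have c: "Re a * Im b - Im a * Re b \<le> 0" by (simp add: cross_def)
  \<comment> \<open>The parameter at which the segment meets the real axis. The real part there is
    \<open>cross a b / (Im b - Im a)\<close>.\<close>
  define t where "t = - Im a / (Im b - Im a)"
  define p where "p = (1 - t) *\<^sub>R a + t *\<^sub>R b"
  have t: "0 \<le> t" "t \<le> 1" using im by (auto simp: t_def field_simps)
  have "p \<in> closed_segment a b" using t unfolding p_def in_segment by blast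
  moreover have "Im p = 0" using im by (simp add: p_def t_def field_simps)
  moreover have "Re p = (Re a * Im b - Im a * Re b) / (Im b - Im a)"
  proof -
    have "1 - t = Im b / (Im b - Im a)" using im by (simp add: t_def field_simps)
    then have "Re p = Im b / (Im b - Im a) * Re a + - Im a / (Im b - Im a) * Re b"
      by (simp add: p_def t_def)
    then show ?thesis by (simp add: diff_divide_distrib algebra_simps)
  qed
  then have "Re p \<le> 0" using c im by (simp add: divide_nonpos_pos)
  ultimately show False using assms by (auto simp: complex_nonpos_Reals_iff)
qed

text \<open>\<open>Arg (p / u)\<close> is the branch of the argument cut along the ray opposite to
  \<open>u\<close>. A segment that misses this ray sees no jump, and sums of signed angles measured
  by one \<open>u\<close> telescope.\<close>

lemma signed_angle_eq_diff:
  assumes "u \<noteq> 0" and "\<And>p. p \<in> closed_segment y z \<Longrightarrow> p / u \<notin> \<real>\<^sub>\<le>\<^sub>0"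
  shows "signed_angle y z = Arg (z / u) - Arg (y / u)"
proof -
  have "0 \<notin> closed_segment y z" using assms(2)[of 0] by auto
  then have nz: "y \<noteq> 0" "z \<noteq> 0" "0 \<notin> closed_segment y z" by auto
  have seg: "p \<notin> \<real>\<^sub>\<le>\<^sub>0" if "p \<in> closed_segment (y / u) (z / u)" for p
  proof -
    have "linear (\<lambda>q. q / u)" by (intro linearI) (auto simp: add_divide_distrib scaleR_conv_of_real)
    then have "closed_segment (y / u) (z / u) = (\<lambda>q. q / u) ` closed_segment y z"
      by (rule closed_segment_linear_image[where f = "\<lambda>q. q / u"])
    then show ?thesis using that assms(2) by auto
  qed
  have "Arg (z / u) - Arg (y / u) < pi"
    by (rule Arg_diff_segment_less_pi) (rule seg)
  moreover have "Arg (y / u) - Arg (z / u) < pi"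
    by (rule Arg_diff_segment_less_pi) (rule seg, simp add: closed_segment_commute)
  ultimately have "Arg ((z / u) / (y / u)) = Arg (z / u) - Arg (y / u)"
    using nz assms(1) by (subst Arg_divide') auto
  moreover have "(z / u) / (y / u) = z / y" using assms(1) by simp
  ultimately show ?thesis using signed_angle_eq_Arg nz by simp
qed

section \<open>Additivity of signed angles over convex sets that miss the origin\<close>

lemma convex_separate_zero:
  fixes S :: "complex set"
  assumes "convex S" "compact S" "S \<noteq> {}" "0 \<notin> S"
  obtains u where "u \<noteq> 0" "\<And>p. p \<in> S \<Longrightarrow> p / u \<notin> \<real>\<^sub>\<le>\<^sub>0"
proof -
  obtain u b where ub: "0 < b" "\<And>p. p \<in> S \<Longrightarrow> u \<bullet> p > b"
    using separating_hyperplane_closed_0[OF assms(1) compact_imp_closed[OF assms(2)] assms(4)] by auto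
  have u: "u \<noteq> 0" using ub assms(3) by force
  have "p / u \<notin> \<real>\<^sub>\<le>\<^sub>0" if "p \<in> S" for p
  proof
    assume "p / u \<in> \<real>\<^sub>\<le>\<^sub>0"
    then obtain r where "r \<le> 0" "p / u = of_real r" by (auto elim: nonpos_Reals_cases)
    then have "p = r *\<^sub>R u" using u by (simp add: field_simps scaleR_conv_of_real)
    then have "u \<bullet> p \<le> 0" using \<open>r \<le> 0\<close> by (simp add: mult_nonpos_nonneg)
    then show False using ub that by force
  qed
  then show ?thesis using u that by blast
qed

text \<open>A line separating \<open>S\<close> from 0 provides one \<open>u\<close> whose opposite
  ray misses \<open>S\<close>, so the same branch measures all three angles.\<close>

lemma signed_angle_add_in_convex:
  assumes "convex S" "compact S" "0 \<notin> S" "p \<in> S" "q \<in> S" "r \<in> S"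
  shows "signed_angle p q + signed_angle q r = signed_angle p r"
proof -
  obtain u where u: "u \<noteq> 0" "\<And>p. p \<in> S \<Longrightarrow> p / u \<notin> \<real>\<^sub>\<le>\<^sub>0"
    using convex_separate_zero[of S] assms by auto
  have "signed_angle p q = Arg (q / u) - Arg (p / u)" if "p \<in> S" "q \<in> S" for p q
    using that u closed_segment_subset[OF that assms(1)] by (intro signed_angle_eq_diff) auto
  then show ?thesis using assms by simp
qed

text \<open>The two sides are the two ways around a unit square of index pairs, from the corner
  \<open>c - a\<close> to the corner \<open>d - b\<close>.\<close>

lemma signed_angle_parallelogram:
  fixes a b c d :: complex
  assumes "closed_segment a b \<inter> closed_segment c d = {}"
  shows "signed_angle (c - a) (d - a) + signed_angle (d - a) (d - b) =
         signed_angle (c - a) (c - b) + signed_angle (c - b) (d - b)"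
proof -
  define S where "S = (\<Union>x\<in>closed_segment c d. \<Union>y\<in>closed_segment a b. {x - y})"
  have "convex S" unfolding S_def by (intro convex_differences convex_closed_segment)
  moreover have "S = {x - y |x y. x \<in> closed_segment c d \<and> y \<in> closed_segment a b}"
    by (auto simp: S_def)
  then have "compact S" by (simp add: compact_differences)
  ultimately have S: "convex S" "compact S" by auto
  have "0 \<notin> S" using assms by (auto simp: S_def)
  moreover have "c - a \<in> S" "d - a \<in> S" "c - b \<in> S" "d - b \<in> S" by (auto simp: S_def)
  ultimately show ?thesis using signed_angle_add_in_convex[OF S] by metis
qed

lemma signed_angle_scale:
  assumes "\<alpha> > 0" "\<beta> > 0"
  shows "signed_angle (\<alpha> *\<^sub>R v) (\<beta> *\<^sub>R w) = signed_angle v w"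
proof -
  have "cross (\<alpha> *\<^sub>R v) (\<beta> *\<^sub>R w) = (\<alpha> * \<beta>) * cross v w" by (simp add: cross_def algebra_simps)
  then have "sgn (cross (\<alpha> *\<^sub>R v) (\<beta> *\<^sub>R w)) = sgn (cross v w)" using assms by (simp add: sgn_mult)
  moreover have "(\<alpha> *\<^sub>R v) \<bullet> (\<beta> *\<^sub>R w) / (norm (\<alpha> *\<^sub>R v) * norm (\<beta> *\<^sub>R w)) = v \<bullet> w / (norm v * norm w)"
    using assms by simp
  ultimately show ?thesis by (simp only: signed_angle_def)
qed

text \<open>This is the cell on the diagonal, where the two edges are consecutive and the square
  degenerates to a triangle: \<open>a\<close> and \<open>b\<close> are the shifts and
  \<open>a + b\<close> is the secant across both. Half of \<open>a + b\<close> is the midpoint of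
  the segment, so all three directions occur in one convex set.\<close>

lemma signed_angle_triangle:
  assumes "0 \<notin> closed_segment a b"
  shows "signed_angle a (a + b) + signed_angle (a + b) b = signed_angle a b"
proof -
  define S where "S = closed_segment a b"
  obtain u where u: "u \<noteq> 0" "\<And>p. p \<in> S \<Longrightarrow> p / u \<notin> \<real>\<^sub>\<le>\<^sub>0"
    using convex_separate_zero[of S] assms by (auto simp: S_def)
  have m: "(a + b) /\<^sub>R 2 \<in> S"
    unfolding S_def by (metis midpoint_def midpoint_in_closed_segment)
  have "signed_angle a ((a + b) /\<^sub>R 2) + signed_angle ((a + b) /\<^sub>R 2) b = signed_angle a b"
    using m assms by (intro signed_angle_add_in_convex[of S]) (auto simp: S_def)
  moreover have "signed_angle a ((a + b) /\<^sub>R 2) = signed_angle a (a + b)"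
    using signed_angle_scale[of 1 "inverse 2" a "a + b"] by simp
  moreover have "signed_angle ((a + b) /\<^sub>R 2) b = signed_angle (a + b) b"
    using signed_angle_scale[of "inverse 2" 1 "a + b" b] by simp
  ultimately show ?thesis by simp
qed

lemma signed_angle_self: "signed_angle v v = 0"
  by (simp add: signed_angle_def cross_def)

lemma signed_angle_uminus: "signed_angle (- v) (- w) = signed_angle v w"
  by (simp add: signed_angle_def cross_def)

text \<open>Opposite consecutive shifts would make the two edges overlap near their common
  vertex.\<close>

lemma zero_notin_segment_adjacent:
  fixes a b c :: complex
  assumes "closed_segment a b \<inter> closed_segment b c = {b}" "a \<noteq> b" "b \<noteq> c"
  shows "0 \<notin> closed_segment (b - a) (c - b)"
proof
  assume "0 \<in> closed_segment (b - a) (c - b)"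
  then obtain t where t: "0 \<le> t" "t \<le> 1" "(1 - t) *\<^sub>R (b - a) + t *\<^sub>R (c - b) = 0"
    unfolding in_segment by auto
  have "t \<noteq> 0" "t \<noteq> 1" using t assms(2,3) by auto
  then have t01: "0 < t" "t < 1" using t by auto
  have seg: "b + k *\<^sub>R (d - b) \<in> closed_segment b d" if "0 \<le> k" "k \<le> 1" for k and d :: complex
    unfolding in_segment using that by (intro exI[of _ k]) (simp add: algebra_simps)
  \<comment> \<open>Since \<open>t *\<^sub>R (c - b) = (1 - t) *\<^sub>R (a - b)\<close>, this point
    lies on both edges, with coefficients \<open>(1 - t) * t\<close> and
    \<open>(1 - t) * (1 - t)\<close> in the unit interval.\<close>
  define q where "q = b + ((1-t) * t) *\<^sub>R (c - b)"
  have "(1-t) * t \<le> 1" "(1-t) * (1-t) \<le> 1" "0 \<le> (1-t) * t" "0 \<le> (1-t) * (1-t)"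
    using t01 by (simp_all add: mult_le_one)
  note k = this
  have "q \<in> closed_segment b c" unfolding q_def using k by (intro seg) auto
  moreover have "q \<in> closed_segment a b"
  proof -
    have "t *\<^sub>R (c - b) = - ((1 - t) *\<^sub>R (b - a))" using t(3) by (simp add: add_eq_0_iff)
    also have "\<dots> = (1 - t) *\<^sub>R (a - b)" by (simp add: scaleR_minus_right[symmetric] del: scaleR_minus_right)
    finally have "t *\<^sub>R (c - b) = (1 - t) *\<^sub>R (a - b)" .
    then have "(1-t) *\<^sub>R (t *\<^sub>R (c - b)) = (1-t) *\<^sub>R ((1 - t) *\<^sub>R (a - b))" by (rule arg_cong)
    then have "q = b + ((1-t)*(1-t)) *\<^sub>R (a - b)" unfolding q_def scaleR_scaleR by simp
    then show ?thesis using seg[of "(1-t)*(1-t)" a] k by (simp add: closed_segment_commute)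
  qed
  ultimately have "q = b" using assms(1) by blast
  then show False using t01 assms by (simp add: q_def)
qed

subsection \<open>Hopf's Umlaufsatz for open polylines\<close>

text \<open>The left side follows the diagonal of the triangle of index pairs \<open>i < j\<close>;
  the right side follows its two legs, where first the start of the secant stays at
  \<open>l 0\<close> and then its end stays at \<open>l N\<close>. Each step of the induction on
  \<open>N\<close> appends the strip of cells between the secants ending in two successive
  vertices.\<close>

lemma hopf_open:
  fixes l :: "nat \<Rightarrow> complex"
  assumes ne: "\<And>i. i < N \<Longrightarrow> l i \<noteq> l (Suc i)"
    and adj: "\<And>i. Suc i < N \<Longrightarrow>
      closed_segment (l i) (l (Suc i)) \<inter> closed_segment (l (Suc i)) (l (Suc (Suc i))) = {l (Suc i)}"
    and dis: "\<And>i j. \<lbrakk>Suc i < j; j < N\<rbrakk> \<Longrightarrow>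
      closed_segment (l i) (l (Suc i)) \<inter> closed_segment (l j) (l (Suc j)) = {}"
  shows "(\<Sum>i<N - 1. signed_angle (l (Suc i) - l i) (l (Suc (Suc i)) - l (Suc i))) =
    (\<Sum>j\<in>{1..<N}. signed_angle (l j - l 0) (l (Suc j) - l 0)) +
    (\<Sum>i<N - 1. signed_angle (l N - l i) (l N - l (Suc i)))"
  using assms
proof (induction N)
  case 0
  then show ?case by simp
next
  case (Suc N)
  define h where "h i j = signed_angle (l j - l i) (l (Suc j) - l i)" for i j
  define w where "w i j = signed_angle (l j - l i) (l j - l (Suc i))" for i j
  define c where "c i = signed_angle (l (Suc i) - l i) (l (Suc (Suc i)) - l (Suc i))" for i
  have IH: "(\<Sum>i<N - 1. c i) = (\<Sum>j\<in>{1..<N}. h 0 j) + (\<Sum>i<N - 1. w i N)"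
    unfolding c_def h_def w_def by (rule Suc.IH) (use Suc.prems in auto)
  have "(\<Sum>i<Suc N - 1. c i) = (\<Sum>j\<in>{1..<Suc N}. h 0 j) + (\<Sum>i<Suc N - 1. w i (Suc N))"
  proof (cases N)
    case 0
    then show ?thesis by simp
  next
    case (Suc m)
    \<comment> \<open>The squares of the new strip; their contributions from \<open>h\<close>
      telescope.\<close>
    have sq: "w i (Suc N) = w i N + (h (Suc i) N - h i N)" if "i < m" for i
      using signed_angle_parallelogram[OF Suc.prems(3)[of i N]] that Suc by (simp add: h_def w_def)
    \<comment> \<open>The triangle that closes the strip at the diagonal; it supplies the new
      turning angle \<open>c m\<close>.\<close>
    have tri: "h m N + w m (Suc N) = c m"
    proof -
      have "0 \<notin> closed_segment (l (Suc m) - l m) (l (Suc (Suc m)) - l (Suc m))"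
        using Suc.prems(1)[of m] Suc.prems(1)[of "Suc m"] Suc.prems(2)[of m] Suc
        by (intro zero_notin_segment_adjacent) auto
      from signed_angle_triangle[OF this] show ?thesis by (simp add: h_def w_def c_def Suc)
    qed
    have "(\<Sum>i<m. w i (Suc N)) = (\<Sum>i<m. w i N) + (\<Sum>i<m. h (Suc i) N - h i N)"
      by (simp add: sq sum.distrib)
    also have "(\<Sum>i<m. h (Suc i) N - h i N) = h m N - h 0 N"
      by (rule sum_lessThan_telescope)
    finally have "(\<Sum>i<Suc m. w i (Suc N)) = (\<Sum>i<m. w i N) + c m - h 0 N"
      using tri by simp
    then show ?thesis using IH by (simp add: Suc)
  qed
  then show ?case unfolding c_def h_def w_def .
qed

subsection \<open>Simple closed polylines as periodic sequences\<close>

definition side :: "(int \<Rightarrow> complex) \<Rightarrow> int \<Rightarrow> complex set" where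
  "side v i = closed_segment (v i) (v (i + 1))"

text \<open>Periodic indexing by the integers replaces the successor modulo \<open>n\<close>, so
  that arcs may start at any vertex and never wrap around. The range \<open>i + 1 < j\<close>,
  \<open>j + 1 < i + int n\<close> consists of sides that are neither equal nor adjacent modulo
  \<open>n\<close>.\<close>

definition simple_cycle :: "nat \<Rightarrow> (int \<Rightarrow> complex) \<Rightarrow> bool" where
  "simple_cycle n v \<longleftrightarrow> 3 \<le> n \<and> (\<forall>i. v (i + int n) = v i) \<and> (\<forall>i. v i \<noteq> v (i + 1)) \<and>
     (\<forall>i. side v i \<inter> side v (i + 1) = {v (i + 1)}) \<and>
     (\<forall>i j. i + 1 < j \<and> j + 1 < i + int n \<longrightarrow> side v i \<inter> side v j = {})"

definition cycle_list :: "nat \<Rightarrow> (int \<Rightarrow> complex) \<Rightarrow> complex list" where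
  "cycle_list n v = map (\<lambda>i. v (int i)) [0..<Suc n]"

lemma length_cycle_list [simp]: "length (cycle_list n v) = Suc n"
  by (simp add: cycle_list_def)

lemma nth_cycle_list: "i \<le> n \<Longrightarrow> cycle_list n v ! i = v (int i)"
  unfolding cycle_list_def by (subst nth_map) (auto simp del: upt_Suc)

lemma simple_cycle_ge3: "simple_cycle n v \<Longrightarrow> 3 \<le> n"
  and simple_cycle_periodic: "simple_cycle n v \<Longrightarrow> v (i + int n) = v i"
  and simple_cycle_neq: "simple_cycle n v \<Longrightarrow> v i \<noteq> v (i + 1)"
  and simple_cycle_adj: "simple_cycle n v \<Longrightarrow> side v i \<inter> side v (i + 1) = {v (i + 1)}"
  and simple_cycle_disjoint:
    "simple_cycle n v \<Longrightarrow> i + 1 < j \<Longrightarrow> j + 1 < i + int n \<Longrightarrow> side v i \<inter> side v j = {}"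
  by (auto simp: simple_cycle_def)

lemma simple_cycle_mod:
  assumes "simple_cycle n v"
  shows "v (i mod int n) = v i"
proof -
  have k: "v (j + int k * int n) = v j" for j k
  proof (induction k)
    case (Suc k)
    have "v (j + int (Suc k) * int n) = v ((j + int k * int n) + int n)" by (simp add: algebra_simps)
    then show ?case using Suc simple_cycle_periodic[OF assms] by simp
  qed simp
  have pos: "v (j mod int n + q * int n) = v (j mod int n)" for j q
  proof (cases "q \<ge> 0")
    case True
    then show ?thesis using k[of "j mod int n" "nat q"] by simp
  next
    case False
    then show ?thesis using k[of "j mod int n + q * int n" "nat (- q)"] by simp
  qed
  show ?thesis using pos[of i "i div int n"] by simp
qed

lemma simple_cycle_side_mod:
  assumes "simple_cycle n v"
  shows "side v (i mod int n) = side v i"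
  unfolding side_def using simple_cycle_mod[OF assms]
  by (metis mod_add_left_eq)

lemma simple_cycle_shift: "simple_cycle n v \<Longrightarrow> simple_cycle n (\<lambda>i. v (i + k))"
proof -
  assume v: "simple_cycle n v"
  have s: "side (\<lambda>i. v (i + k)) i = side v (i + k)" for i
    by (simp add: side_def algebra_simps)
  have "v (i + int n + k) = v (i + k)" for i
    using simple_cycle_periodic[OF v, of "i + k"] by (simp add: algebra_simps)
  moreover have "v (i + k) \<noteq> v (i + 1 + k)" for i
    using simple_cycle_neq[OF v, of "i + k"] by (simp add: algebra_simps)
  moreover have "side v (i + k) \<inter> side v (i + 1 + k) = {v (i + 1 + k)}" for i
    using simple_cycle_adj[OF v, of "i + k"] by (simp add: algebra_simps)
  moreover have "side v (i + k) \<inter> side v (j + k) = {}" if "i + 1 < j" "j + 1 < i + int n" for i j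
    using simple_cycle_disjoint[OF v, of "i + k" "j + k"] that by simp
  ultimately show ?thesis
    unfolding simple_cycle_def s using simple_cycle_ge3[OF v] by blast
qed

lemma simple_cycle_reverse: "simple_cycle n v \<Longrightarrow> simple_cycle n (\<lambda>i. v (- i))"
proof -
  assume v: "simple_cycle n v"
  have s: "side (\<lambda>i. v (- i)) i = side v (- i - 1)" for i
    by (simp add: side_def closed_segment_commute)
  have "v (- (i + int n)) = v (- i)" for i
    using simple_cycle_periodic[OF v, of "- (i + int n)"] by simp
  moreover have "v (- i) \<noteq> v (- (i + 1))" for i
    using simple_cycle_neq[OF v, of "- (i + 1)"] by simp
  moreover have "side v (- i - 1) \<inter> side v (- (i + 1) - 1) = {v (- (i + 1))}" for i
  proof -
    have "- (i + 1) - 1 + 1 = - i - 1" "- (i + 1) = - i - 1" by simp_all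
    then show ?thesis using simple_cycle_adj[OF v, of "- (i + 1) - 1"] by (metis Int_commute)
  qed
  moreover have "side v (- i - 1) \<inter> side v (- j - 1) = {}" if "i + 1 < j" "j + 1 < i + int n" for i j
    using simple_cycle_disjoint[OF v, of "- j - 1" "- i - 1"] that by (simp add: Int_commute)
  ultimately show ?thesis
    unfolding simple_cycle_def s using simple_cycle_ge3[OF v] by blast
qed

lemma int_mod_neq_of_close:
  fixes a b :: int
  assumes "0 < b - a" "b - a < n"
  shows "a mod n \<noteq> b mod n"
proof
  assume "a mod n = b mod n"
  then have "n dvd b - a" by (metis mod_eq_dvd_iff)
  then show False using assms zdvd_imp_le by fastforce
qed

lemma simple_cycle_of_list:
  assumes "simple_closed_polyline vs"
  obtains n v where "simple_cycle n v" "vs = cycle_list n v"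
proof -
  define n where "n = length vs - 1"
  have cl: "closed_polyline vs"
    and adj: "\<And>i. i < n \<Longrightarrow> edge vs i \<inter> edge vs (Suc i mod n) = {vs ! Suc i}"
    and dis: "\<And>i j. \<lbrakk>i < n; j < n; i \<noteq> j; j \<noteq> Suc i mod n; i \<noteq> Suc j mod n\<rbrakk> \<Longrightarrow> edge vs i \<inter> edge vs j = {}"
    using assms unfolding simple_closed_polyline_def Let_def n_def by auto
  have len: "length vs = Suc n" "1 \<le> n" and da: "distinct_adj vs"
    using cl by (auto simp: closed_polyline_def polyline_def n_def)
  have close: "vs ! 0 = vs ! n"
    using cl len unfolding closed_polyline_def
    by (metis hd_conv_nth last_conv_nth list.size(3) n_def nat.distinct(1))
  have ne: "vs ! i \<noteq> vs ! Suc i" if "i < n" for i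
    using da that len by (simp add: distinct_adj_conv_nth)
  have "n \<noteq> 1" using ne[of 0] close by auto
  \<comment> \<open>With two edges, both would be the same segment and could not meet in a single
    point.\<close>
  moreover have "n \<noteq> 2"
  proof
    assume n: "n = 2"
    then have e: "edge vs 0 \<inter> edge vs 1 = {vs ! 1}" using adj[of 0] by simp
    have "edge vs 1 = edge vs 0"
      using close n closed_segment_commute[of "vs ! 1" "vs ! 0"] by (simp add: edge_def numeral_2_eq_2)
    then have "edge vs 0 = {vs ! 1}" using e by simp
    moreover have "vs ! 0 \<in> edge vs 0" by (simp add: edge_def)
    ultimately have "vs ! 0 = vs ! 1" by simp
    then show False using ne[of 0] n by simp
  qed
  ultimately have n3: "3 \<le> n" using len by simp
  define v where "v i = vs ! nat (i mod int n)" for i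
  define r where "r i = nat (i mod int n)" for i
  have r: "r i < n" for i using n3 by (simp add: r_def nat_less_iff)
  have rS: "r (i + 1) = Suc (r i) mod n" for i
  proof -
    have "int (r (i + 1)) = (i + 1) mod int n" using n3 by (simp add: r_def)
    also have "\<dots> = (i mod int n + 1) mod int n" by (simp add: mod_simps)
    also have "\<dots> = int (Suc (r i) mod n)" using n3 by (simp add: r_def zmod_int add.commute)
    finally show ?thesis by simp
  qed
  have vS: "v (i + 1) = vs ! Suc (r i)" for i
  proof (cases "Suc (r i) = n")
    case True
    then show ?thesis using rS[of i] close by (simp add: v_def r_def)
  next
    case False
    then have "Suc (r i) < n" using r[of i] by simp
    then show ?thesis using rS[of i] by (simp add: v_def r_def)
  qed
  have s: "side v i = edge vs (r i)" for i
    by (simp add: side_def edge_def vS) (simp add: v_def r_def)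
  have "simple_cycle n v"
    unfolding simple_cycle_def
  proof (intro conjI allI impI)
    show "v (i + int n) = v i" for i by (simp add: v_def)
    show "v i \<noteq> v (i + 1)" for i unfolding vS using ne[OF r[of i]] by (simp add: v_def r_def)
    show "side v i \<inter> side v (i + 1) = {v (i + 1)}" for i
      unfolding s rS vS using adj[OF r] by simp
    show "side v i \<inter> side v j = {}" if ij: "i + 1 < j \<and> j + 1 < i + int n" for i j
      unfolding s
    proof (rule dis[OF r r])
      have req: "r a \<noteq> r b" if "0 < b - a" "b - a < int n" for a b
      proof -
        have "int (r a) \<noteq> int (r b)" using int_mod_neq_of_close[OF that] n3 by (simp add: r_def)
        then show ?thesis by simp
      qed
      show "r i \<noteq> r j" by (rule req) (use ij in auto)
      show "r j \<noteq> Suc (r i) mod n"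
        unfolding rS[symmetric] by (rule req[symmetric]) (use ij in auto)
      show "r i \<noteq> Suc (r j) mod n"
        unfolding rS[symmetric] by (rule req) (use ij in auto)
    qed
  qed (use n3 in auto)
  moreover have "vs = cycle_list n v"
  proof (rule nth_equalityI)
    fix i assume "i < length vs"
    then have i: "i \<le> n" using len by simp
    show "vs ! i = cycle_list n v ! i"
      unfolding nth_cycle_list[OF i] using i close n3
      by (cases "i = n") (auto simp: v_def zmod_int[symmetric])
  qed (simp add: len)
  ultimately show ?thesis using that by blast
qed

lemma edge_cycle_list:
  assumes "i < n"
  shows "edge (cycle_list n v) i = side v (int i)"
  using assms by (simp add: edge_def side_def nth_cycle_list algebra_simps)

lemma simple_closed_polyline_cycle_list:
  assumes v: "simple_cycle n v"
  shows "simple_closed_polyline (cycle_list n v)"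
proof -
  have n3: "3 \<le> n" by (rule simple_cycle_ge3[OF v])
  have v0: "v (int n) = v 0" using simple_cycle_periodic[OF v, of 0] by simp
  have s0: "side v (int n) = side v 0" using simple_cycle_side_mod[OF v, of "int n"] by simp
  have "v (int i) \<noteq> v (1 + int i)" for i
    using simple_cycle_neq[OF v, of "int i"] by (simp add: add.commute)
  then have "distinct_adj (cycle_list n v)"
    unfolding distinct_adj_conv_nth by (simp add: nth_cycle_list)
  moreover have "hd (cycle_list n v) = last (cycle_list n v)"
    using v0 by (simp add: cycle_list_def hd_map last_map del: upt_Suc)
  ultimately have "closed_polyline (cycle_list n v)"
    using n3 by (simp add: closed_polyline_def polyline_def)
  moreover have "edge (cycle_list n v) i \<inter> edge (cycle_list n v) (Suc i mod n) = {cycle_list n v ! Suc i}"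
    if "i < n" for i
  proof -
    have i: "int i + 1 = int (Suc i)" by simp
    have "edge (cycle_list n v) (Suc i mod n) = side v (int i + 1)"
    proof (cases "Suc i = n")
      case True
      then show ?thesis unfolding i True using n3 s0 by (simp add: edge_cycle_list)
    next
      case False
      then show ?thesis unfolding i using that by (simp add: edge_cycle_list)
    qed
    moreover have "cycle_list n v ! Suc i = v (int i + 1)"
      unfolding i using that by (intro nth_cycle_list) simp
    ultimately show ?thesis
      using simple_cycle_adj[OF v, of "int i"] edge_cycle_list[OF that] by metis
  qed
  moreover have "edge (cycle_list n v) i \<inter> edge (cycle_list n v) j = {}"
    if "i < n" "j < n" "i \<noteq> j" "j \<noteq> Suc i mod n" "i \<noteq> Suc j mod n" for i j
  proof -
    have *: "side v (int i) \<inter> side v (int j) = {}"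
      if ij: "i < j" "j < n" "j \<noteq> Suc i mod n" "i \<noteq> Suc j mod n" for i j
    proof -
      have "j \<noteq> Suc i" using ij by auto
      moreover have "i \<noteq> 0 \<or> Suc j \<noteq> n" using ij by auto
      ultimately show ?thesis using ij by (intro simple_cycle_disjoint[OF v]) auto
    qed
    show ?thesis
      using *[of i j] *[of j i] that by (cases "i < j") (auto simp: edge_cycle_list)
  qed
  ultimately show ?thesis
    unfolding simple_closed_polyline_def Let_def by simp
qed

lemma polyline_set_cycle_list:
  assumes v: "simple_cycle n v"
  shows "polyline_set (cycle_list n v) = (\<Union>i. side v i)"
proof -
  have "polyline_set (cycle_list n v) = (\<Union>i<n. side v (int i))"
    by (simp add: polyline_set_def edge_cycle_list)
  also have "\<dots> = (\<Union>i. side v i)"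
  proof (intro equalityI UN_least)
    fix i
    have "side v i = side v (int (nat (i mod int n)))"
      using simple_cycle_side_mod[OF v] simple_cycle_ge3[OF v] by simp
    moreover have "nat (i mod int n) < n" using simple_cycle_ge3[OF v] by (simp add: nat_less_iff)
    ultimately show "side v i \<subseteq> (\<Union>i<n. side v (int i))" by blast
  qed auto
  finally show ?thesis .
qed

definition shift_angle :: "(int \<Rightarrow> complex) \<Rightarrow> int \<Rightarrow> real" where
  "shift_angle v i = signed_angle (v (i + 1) - v i) (v (i + 2) - v (i + 1))"

lemma shifts_cycle_list: "shifts (cycle_list n v) = map (\<lambda>i. v (int i + 1) - v (int i)) [0..<n]"
  unfolding shifts_def by (simp add: nth_cycle_list algebra_simps)

lemma closed_rot_cycle_list:
  assumes v: "simple_cycle n v"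
  shows "closed_rot (cycle_list n v) = (\<Sum>i<n. shift_angle v (int i))"
proof -
  have n3: "3 \<le> n" by (rule simple_cycle_ge3[OF v])
  have sh: "shifts (cycle_list n v) ! i = v (int i + 1) - v (int i)" if "i < n" for i
    using that by (simp add: shifts_cycle_list)
  have "signed_angle (shifts (cycle_list n v) ! i) (shifts (cycle_list n v) ! (Suc i mod n)) =
    shift_angle v (int i)" if i: "i < n" for i
  proof (cases "Suc i = n")
    case True
    then have "int i + 1 = 0 + int n" "int i + 2 = 1 + int n" by auto
    then have "v (int i + 1) = v 0" "v (int i + 2) = v 1"
      using simple_cycle_periodic[OF v] by metis+
    moreover have "Suc i mod n = 0" "0 < n" using True by auto
    ultimately show ?thesis using sh[OF i] sh[of 0] by (simp add: shift_angle_def)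
  next
    case False
    then have S: "Suc i mod n = Suc i" "Suc i < n" using i by auto
    have "int (Suc i) = int i + 1" "int (Suc i) + 1 = int i + 2" by auto
    then show ?thesis unfolding S(1) sh[OF S(2)] sh[OF i] shift_angle_def by metis
  qed
  then show ?thesis
    unfolding closed_rot_def Let_def by (simp add: shifts_cycle_list)
qed

lemma simple_cycle_vertex_neq:
  assumes v: "simple_cycle n v" and "i < j" "j < i + int n"
  shows "v i \<noteq> v j"
proof -
  have vs: "v k \<in> side v k" for k by (simp add: side_def)
  consider "j = i + 1" | "j = i + int n - 1" | "i + 1 < j" "j + 1 < i + int n" using assms by linarith
  then show ?thesis
  proof cases
    case 1 then show ?thesis using simple_cycle_neq[OF v] by simp
  next
    case 2 then show ?thesis
      using simple_cycle_neq[OF v, of j] simple_cycle_periodic[OF v, of i] by simp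
  next
    case 3 then show ?thesis using simple_cycle_disjoint[OF v 3] vs[of i] vs[of j] by auto
  qed
qed

lemma simple_cycle_turn:
  assumes v: "simple_cycle n v"
  shows "0 \<notin> closed_segment (v (i + 1) - v i) (v (i + 2) - v (i + 1))"
  using simple_cycle_adj[OF v, of i] simple_cycle_neq[OF v, of i] simple_cycle_neq[OF v, of "i + 1"]
  by (intro zero_notin_segment_adjacent) (auto simp: side_def algebra_simps)

subsection \<open>Hopf's Umlaufsatz for closed polylines\<close>

text \<open>The half-open half-plane, with the positive real axis included: it contains every
  direction from the lexicographically lowest vertex to another one, is convex, and misses the cut
  of \<open>Arg\<close>.\<close>

definition upper :: "complex \<Rightarrow> bool" where
  "upper p \<longleftrightarrow> Im p > 0 \<or> Im p = 0 \<and> Re p > 0"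

lemma convex_upper: "convex {p. upper p}"
proof (rule convexI)
  fix x y :: complex and a b :: real
  assume "x \<in> {p. upper p}" "y \<in> {p. upper p}" and ab: "0 \<le> a" "0 \<le> b" "a + b = 1"
  then have xy: "upper x" "upper y" by auto
  show "a *\<^sub>R x + b *\<^sub>R y \<in> {p. upper p}"
  proof (cases "a = 0 \<or> b = 0")
    case True
    then show ?thesis using ab xy by auto
  next
    case False
    then have "a > 0" "b > 0" using ab by auto
    then show ?thesis using xy
      by (auto simp: upper_def add_pos_pos add_pos_nonneg add_nonneg_pos)
  qed
qed

lemma Arg_upper: "upper p \<Longrightarrow> 0 \<le> Arg p \<and> Arg p < pi"
  using Arg_less_0[of p] Arg_le_pi[of p] Arg_eq_pi[of p] by (fastforce simp: upper_def)

lemma signed_angle_upper: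
  assumes "upper y" "upper z"
  shows "signed_angle y z = Arg z - Arg y"
proof -
  have "closed_segment y z \<subseteq> {p. upper p}"
    using assms by (intro closed_segment_subset convex_upper) auto
  then show ?thesis
    using signed_angle_eq_diff[of 1 y z] by (force simp: upper_def complex_nonpos_Reals_iff)
qed

text \<open>The cycle is cut open by leaving out the side from \<open>v 0\<close> to
  \<open>v 1\<close>, and \<open>hopf_open\<close> is applied to the rest. All secants at
  \<open>v 0\<close> have a direction in \<open>upper\<close>, up to sign, so their variation is
  read off from \<open>Arg\<close>. The order of the directions to the two neighbours of
  \<open>v 0\<close> singles out the counterclockwise orientation.\<close>

lemma umlaufsatz:
  assumes v: "simple_cycle n v"
    and up: "\<And>i. 0 < i \<Longrightarrow> i < int n \<Longrightarrow> upper (v i - v 0)"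
    and arg: "Arg (v 1 - v 0) < Arg (v (-1) - v 0)"
  shows "(\<Sum>i<n. shift_angle v (int i)) = 2 * pi"
proof -
  define N where "N = n - 1"
  have n: "n = Suc N" "2 \<le> N" using simple_cycle_ge3[OF v] by (auto simp: N_def)
  have vn: "v (1 + int N) = v 0" using simple_cycle_periodic[OF v, of 0] n by simp
  have vN: "v (int N) = v (-1)" using simple_cycle_periodic[OF v, of "-1"] n by simp
  define A where "A i = Arg (v (int i) - v 0)" for i
  \<comment> \<open>The chain runs from \<open>v 1\<close> through all vertices back to
    \<open>v 0\<close>. The turns at its ends, \<open>shift_angle v 0\<close> at \<open>v 1\<close>
    and \<open>shift_angle v (int N)\<close> at \<open>v 0\<close>, are added separately.\<close>
  define l where "l k = v (int k + 1)" for k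
  define w where "w i = signed_angle (v (int i) - v 0) (v (int i) - v 1)" for i
  define h where "h i = signed_angle (v (int i) - v 1) (v (int i + 1) - v 1)" for i
  have seen: "signed_angle (v (int i) - v 0) (v (int i + 1) - v 0) = A (Suc i) - A i"
    if "0 < i" "i < N" for i
    using that up[of "int i"] up[of "int i + 1"] n
    by (subst signed_angle_upper) (auto simp: A_def algebra_simps)
  have hopf: "(\<Sum>i<N - 1. signed_angle (l (Suc i) - l i) (l (Suc (Suc i)) - l (Suc i))) =
    (\<Sum>j\<in>{1..<N}. signed_angle (l j - l 0) (l (Suc j) - l 0)) +
    (\<Sum>i<N - 1. signed_angle (l N - l i) (l N - l (Suc i)))"
  proof (rule hopf_open)
    show "l i \<noteq> l (Suc i)" for i
      using simple_cycle_neq[OF v, of "int i + 1"] by (simp add: l_def algebra_simps)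
    show "closed_segment (l i) (l (Suc i)) \<inter> closed_segment (l (Suc i)) (l (Suc (Suc i))) = {l (Suc i)}" for i
      using simple_cycle_adj[OF v, of "int i + 1"] by (simp add: l_def side_def algebra_simps)
    show "closed_segment (l i) (l (Suc i)) \<inter> closed_segment (l j) (l (Suc j)) = {}"
      if "Suc i < j" "j < N" for i j
      using simple_cycle_disjoint[OF v, of "int i + 1" "int j + 1"] that n
      by (simp add: l_def side_def algebra_simps)
  qed
  have second: "(\<Sum>i<N - 1. signed_angle (l N - l i) (l N - l (Suc i))) = A N - A 1"
  proof -
    have "signed_angle (l N - l i) (l N - l (Suc i)) = A (Suc (Suc i)) - A (Suc i)" if "i < N - 1" for i
    proof -
      have "l N - l i = - (v (int (Suc i)) - v 0)" "l N - l (Suc i) = - (v (int (Suc i) + 1) - v 0)"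
        using vn by (simp_all add: l_def algebra_simps)
      then show ?thesis using seen[of "Suc i"] that by (simp only: signed_angle_uminus)
    qed
    then have "(\<Sum>i<N - 1. signed_angle (l N - l i) (l N - l (Suc i))) =
        (\<Sum>i<N - 1. A (Suc (Suc i)) - A (Suc i))" by simp
    also have "\<dots> = A (Suc (N - 1)) - A (Suc 0)" by (rule sum_lessThan_telescope)
    finally show ?thesis using n by simp
  qed
  \<comment> \<open>Squares against the side from \<open>v 0\<close> to \<open>v 1\<close> move the
    observer from \<open>v 1\<close> to \<open>v 0\<close>. They exist for \<open>j\<close> from 2
    to \<open>N - 1\<close>; the side ending in \<open>v 0\<close> touches that side, so
    \<open>h N\<close> is left over and is settled by a triangle in \<open>wh\<close>.\<close>
  have first: "(\<Sum>j\<in>{1..<N}. signed_angle (l j - l 0) (l (Suc j) - l 0)) =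
    A N - A 2 + w N - w 2 + h N"
  proof -
    have "(\<Sum>j\<in>{1..<N}. signed_angle (l j - l 0) (l (Suc j) - l 0)) = (\<Sum>j\<in>{1..<N}. h (Suc j))"
      by (intro sum.cong) (auto simp: l_def h_def algebra_simps)
    also have "\<dots> = (\<Sum>j\<in>{2..<Suc N}. h j)"
      using sum.shift_bounds_Suc_ivl[of h 1 N] by (simp add: numeral_2_eq_2)
    also have "\<dots> = (\<Sum>j\<in>{2..<N}. h j) + h N" using n by simp
    also have "(\<Sum>j\<in>{2..<N}. h j) = (\<Sum>j\<in>{2..<N}. (A (Suc j) + w (Suc j)) - (A j + w j))"
    proof (rule sum.cong)
      fix j assume j: "j \<in> {2..<N}"
      have "side v 0 \<inter> side v (int j) = {}" using j n by (intro simple_cycle_disjoint[OF v]) auto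
      then have "signed_angle (v (int j) - v 0) (v (int j + 1) - v 0) + w (Suc j) = w j + h j"
        unfolding w_def h_def side_def
        using signed_angle_parallelogram[of "v 0" "v 1" "v (int j)" "v (int j + 1)"]
        by (simp add: algebra_simps)
      then show "h j = (A (Suc j) + w (Suc j)) - (A j + w j)" using seen[of j] j by auto
    qed simp
    also have "\<dots> = (A N + w N) - (A 2 + w 2)"
      using n by (subst sum_Suc_diff') auto
    finally show ?thesis by simp
  qed
  have c0: "shift_angle v 0 = A 2 - A 1 + w 2"
  proof -
    have "signed_angle (v 1 - v 0) (v 2 - v 0) + w 2 = shift_angle v 0"
      using signed_angle_triangle[OF simple_cycle_turn[OF v, of 0]]
      by (simp add: shift_angle_def w_def)
    moreover have "signed_angle (v 1 - v 0) (v 2 - v 0) = A 2 - A 1"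
      using seen[of 1] n by (simp add: numeral_2_eq_2)
    ultimately show ?thesis by simp
  qed
  define a where "a = v (-1) - v 0"
  define b where "b = v 1 - v 0"
  have turn: "0 \<notin> closed_segment (- a) b"
    using simple_cycle_turn[OF v, of "-1"] by (simp add: a_def b_def)
  then have turn': "0 \<notin> closed_segment a (- b)"
    using closed_segment_linear_image[OF linear_uminus, of "- a" b] by auto
  have nz: "a \<noteq> 0" "b \<noteq> 0" using turn by auto
  have Aab: "Arg b < Arg a" "Arg a = A N" "Arg b = A 1" using arg by (auto simp: a_def b_def A_def vN)
  have "upper a" "upper b" using up[of "int N"] up[of 1] n by (auto simp: a_def b_def vN)
  then have rng: "0 \<le> Arg b" "Arg a < pi" using Arg_upper by auto
  \<comment> \<open>Here \<pi> enters, through the reversal of \<open>a\<close>, whose argument is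
    positive. The same angle reappears in \<open>wh\<close>, and the two copies make up the
    total.\<close>
  have lastturn: "signed_angle (- a) b = A 1 - A N + pi"
  proof -
    have "Arg (- a) = Arg a - pi" using Arg_minus[OF nz(1)] Aab rng by simp
    then have "Arg (b / (- a)) = Arg b - Arg a + pi"
      using nz Aab rng by (subst Arg_divide') auto
    then show ?thesis using signed_angle_eq_Arg[OF turn] Aab by simp
  qed
  have wh: "w N + h N = A 1 - A N + pi"
  proof -
    have "v (int N) - v 0 = a" "v (int N) - v 1 = a + - b" "v (int N + 1) - v 1 = - b"
      using vn vN by (auto simp: a_def b_def algebra_simps)
    then have "w N + h N = signed_angle a (a + - b) + signed_angle (a + - b) (- b)"
      by (simp only: w_def h_def)
    also have "\<dots> = signed_angle a (- b)" by (rule signed_angle_triangle[OF turn'])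
    also have "\<dots> = signed_angle (- a) b" using signed_angle_uminus[of a "- b"] by simp
    finally show ?thesis using lastturn by simp
  qed
  have cN: "shift_angle v (int N) = signed_angle (- a) b"
  proof -
    have "v (int N + 2) = v 1" using simple_cycle_periodic[OF v, of 1] n by (simp add: algebra_simps)
    then show ?thesis using vn vN by (simp add: shift_angle_def a_def b_def algebra_simps)
  qed
  have "(\<Sum>i<n. shift_angle v (int i)) = shift_angle v 0 + (\<Sum>i<N - 1. shift_angle v (int i + 1)) + shift_angle v (int N)"
  proof -
    have "(\<Sum>i<n. shift_angle v (int i)) = (\<Sum>i<Suc (N - 1). shift_angle v (int i)) + shift_angle v (int N)"
      using n by simp
    also have "(\<Sum>i<Suc (N - 1). shift_angle v (int i)) = shift_angle v 0 + (\<Sum>i<N - 1. shift_angle v (int i + 1))"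
      by (subst sum.lessThan_Suc_shift) (simp add: algebra_simps)
    finally show ?thesis .
  qed
  also have "(\<Sum>i<N - 1. shift_angle v (int i + 1)) =
      (\<Sum>i<N - 1. signed_angle (l (Suc i) - l i) (l (Suc (Suc i)) - l (Suc i)))"
    by (intro sum.cong) (auto simp: shift_angle_def l_def algebra_simps)
  finally show ?thesis
    using hopf first second c0 wh cN lastturn by simp
qed

section \<open>Existence of a counterclockwise boundary\<close>

lemma simple_cycle_lowest_vertex:
  assumes v: "simple_cycle n v"
  obtains k where "\<And>i. 0 < i \<Longrightarrow> i < int n \<Longrightarrow> upper (v (i + k) - v k)"
proof -
  define V where "V = v ` {0..<int n}"
  have n3: "3 \<le> n" by (rule simple_cycle_ge3[OF v])
  have fin: "finite V" "V \<noteq> {}" using n3 by (auto simp: V_def)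
  have inV: "v i \<in> V" for i
    using simple_cycle_mod[OF v, of i] n3 unfolding V_def
    by (metis atLeastLessThan_iff image_eqI of_nat_0_less_iff pos_mod_bound pos_mod_sign
        less_le_trans zero_less_numeral)
  define m where "m = Min (Im ` V)"
  \<comment> \<open>Among the vertices of least height the leftmost is chosen; this is the tie rule
    built into \<open>upper\<close>.\<close>
  define W where "W = {p \<in> V. Im p = m}"
  have "m \<in> Im ` V" unfolding m_def using fin by (intro Min_in) auto
  then have W: "finite W" "W \<noteq> {}" using fin by (auto simp: W_def)
  then have "Min (Re ` W) \<in> Re ` W" by (intro Min_in) auto
  then obtain p where p: "p \<in> W" "Re p = Min (Re ` W)" by auto
  then obtain k where k: "p = v k" by (auto simp: W_def V_def)
  have "upper (v (i + k) - v k)" if "0 < i" "i < int n" for i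
  proof -
    have ne: "v (i + k) \<noteq> v k" using simple_cycle_vertex_neq[OF v, of k "i + k"] that by auto
    have "Im (v k) = m" using p k by (simp add: W_def)
    moreover have "m \<le> Im (v (i + k))" unfolding m_def using fin inV by (intro Min_le) auto
    moreover have "Re (v k) \<le> Re (v (i + k))" if "Im (v (i + k)) = m"
      using p(2) k W inV that by (auto simp: W_def)
    ultimately show ?thesis using ne by (auto simp: upper_def complex_eq_iff)
  qed
  then show ?thesis using that by blast
qed

lemma bounds_polygon_cycle_list_cong:
  assumes "simple_cycle n v" "simple_cycle m w" "(\<Union>i. side v i) = (\<Union>i. side w i)"
    and "bounds_polygon (cycle_list n v) K"
  shows "bounds_polygon (cycle_list m w) K"
  using assms(4) simple_closed_polyline_cycle_list[OF assms(2)]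
  unfolding bounds_polygon_def polyline_set_cycle_list[OF assms(1)] polyline_set_cycle_list[OF assms(2)] assms(3)
  by simp

text \<open>Started at the lowest vertex, either the polyline \<open>f\<close> or its reversal
  \<open>g\<close> satisfies the order condition of \<open>umlaufsatz\<close>: equal directions to
  both neighbours would make two consecutive shifts opposite. The choice operator in
  \<open>aco\<close> needs this existence.\<close>

lemma counterclockwise_boundary_exists:
  assumes "simple_polygon K"
  shows "\<exists>P. bounds_polygon P K \<and> closed_rot P = 2 * pi"
proof -
  obtain vs where vs: "bounds_polygon vs K" using assms by (auto simp: simple_polygon_def)
  then obtain n v where v: "simple_cycle n v" "vs = cycle_list n v"
    using simple_cycle_of_list by (metis bounds_polygon_def)
  obtain k where k: "\<And>i. 0 < i \<Longrightarrow> i < int n \<Longrightarrow> upper (v (i + k) - v k)"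
    using simple_cycle_lowest_vertex[OF v(1)] by blast
  define f where "f i = v (i + k)" for i
  define g where "g i = f (- i)" for i
  have f: "simple_cycle n f" unfolding f_def by (rule simple_cycle_shift[OF v(1)])
  then have g: "simple_cycle n g" unfolding g_def by (rule simple_cycle_reverse)
  have sf: "side f i = side v (i + k)" for i by (simp add: side_def f_def algebra_simps)
  have "(\<Union>i. side f i) = (\<Union>i. side v i)"
  proof (intro equalityI UN_least)
    show "side v i \<subseteq> (\<Union>i. side f i)" for i
      using sf[of "i - k"] by auto
  qed (use sf in auto)
  then have bf: "bounds_polygon (cycle_list n f) K"
    using bounds_polygon_cycle_list_cong[OF v(1) f] vs v(2) by simp
  have sg: "side g i = side f (- i - 1)" for i
    by (simp add: side_def g_def closed_segment_commute)
  have "(\<Union>i. side g i) = (\<Union>i. side f i)"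
  proof (intro equalityI UN_least)
    show "side f i \<subseteq> (\<Union>i. side g i)" for i
      using sg[of "- i - 1"] by auto
  qed (use sg in auto)
  then have bg: "bounds_polygon (cycle_list n g) K"
    using bounds_polygon_cycle_list_cong[OF f g] bf by simp
  have upf: "upper (f i - f 0)" if "0 < i" "i < int n" for i
    using k[OF that] by (simp add: f_def)
  have upg: "upper (g i - g 0)" if "0 < i" "i < int n" for i
    using upf[of "int n - i"] that simple_cycle_periodic[OF f, of "- i"] by (simp add: g_def)
  have "Arg (f 1 - f 0) \<noteq> Arg (f (-1) - f 0)"
  proof
    assume eq: "Arg (f 1 - f 0) = Arg (f (-1) - f 0)"
    have nz: "f 1 - f 0 \<noteq> 0" "f (-1) - f 0 \<noteq> 0"
      using simple_cycle_neq[OF f, of 0] simple_cycle_neq[OF f, of "-1"] by auto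
    then obtain x where x: "x > 0" "f 1 - f 0 = of_real x * (f (-1) - f 0)"
      using eq Arg_eq_iff[OF nz] by auto
    have "(f 1 - f 0) / (f 0 - f (-1)) = of_real (- x)" unfolding x(2) using nz by (simp add: divide_eq_eq algebra_simps)
    then have "(f 1 - f 0) / (f 0 - f (-1)) \<in> \<real>\<^sub>\<le>\<^sub>0" using x(1) by simp
    then show False
      using zero_in_segment_imp_nonpos[of "f 0 - f (-1)"] simple_cycle_turn[OF f, of "-1"] nz by auto
  qed
  then consider "Arg (f 1 - f 0) < Arg (f (-1) - f 0)" | "Arg (g 1 - g 0) < Arg (g (-1) - g 0)"
    unfolding g_def by fastforce
  then show ?thesis
  proof cases
    case 1
    then show ?thesis using umlaufsatz[OF f upf] closed_rot_cycle_list[OF f] bf by auto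
  next
    case 2
    then show ?thesis using umlaufsatz[OF g upg] closed_rot_cycle_list[OF g] bg by auto
  qed
qed

subsection \<open>Polylines contained in a simple closed polyline\<close>

definition side_shift :: "(int \<Rightarrow> complex) \<Rightarrow> int \<Rightarrow> complex" where
  "side_shift v j = v (j + 1) - v j"

lemma simple_cycle_side_shift_mod:
  assumes "simple_cycle n v"
  shows "side_shift v (j mod int n) = side_shift v j"
  unfolding side_shift_def using simple_cycle_mod[OF assms] by (metis mod_add_left_eq)

text \<open>Two common points thus determine a side up to the period, which makes the condition in
  \<open>oriented_along\<close> usable.\<close>

lemma sides_Int_subset_vertex:
  assumes v: "simple_cycle n v" and ne: "i mod int n \<noteq> j mod int n"
  shows "\<exists>k. side v i \<inter> side v j \<subseteq> {v k}"
proof -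
  have n3: "3 \<le> n" by (rule simple_cycle_ge3[OF v])
  have *: "\<exists>k. side v a \<inter> side v b \<subseteq> {v k}" if ab: "0 \<le> a" "a < b" "b < int n" for a b
  proof -
    consider "b = a + 1" | "b + 1 = a + int n" | "a + 1 < b" "b + 1 < a + int n" using ab by linarith
    then show ?thesis
    proof cases
      case 1 then show ?thesis using simple_cycle_adj[OF v, of a] by auto
    next
      case 2
      have "side v (b + 1) = side v a"
        using simple_cycle_side_mod[OF v, of "a + int n"] simple_cycle_side_mod[OF v, of a]
        by (simp add: 2)
      then show ?thesis using simple_cycle_adj[OF v, of b] by (auto simp: Int_commute)
    next
      case 3 then show ?thesis using simple_cycle_disjoint[OF v 3] by auto
    qed
  qed
  have b: "0 \<le> k mod int n" "k mod int n < int n" for k using n3 by auto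
  have "\<exists>k. side v (i mod int n) \<inter> side v (j mod int n) \<subseteq> {v k}"
    using *[of "i mod int n" "j mod int n"] *[of "j mod int n" "i mod int n"] b ne
    by (metis Int_commute linorder_neqE_linordered_idom)
  then show ?thesis unfolding simple_cycle_side_mod[OF v] .
qed

lemma oriented_along_cycle_list:
  assumes v: "simple_cycle n v"
  shows "oriented_along L (cycle_list n v) \<longleftrightarrow>
    (\<forall>i j. Suc i < length L \<and> (\<exists>p q. p \<noteq> q \<and> {p, q} \<subseteq> edge L i \<inter> side v j) \<longrightarrow>
      (\<exists>\<alpha>>0. L ! Suc i - L ! i = \<alpha> *\<^sub>R side_shift v j))" (is "_ \<longleftrightarrow> ?rhs")
proof -
  have n3: "3 \<le> n" by (rule simple_cycle_ge3[OF v])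
  have sh: "cycle_list n v ! Suc j - cycle_list n v ! j = side_shift v (int j)" if "j < n" for j
    using that by (simp add: nth_cycle_list side_shift_def add.commute)
  have "oriented_along L (cycle_list n v) \<longleftrightarrow>
    (\<forall>i j. Suc i < length L \<and> j < n \<and> (\<exists>p q. p \<noteq> q \<and> {p, q} \<subseteq> edge L i \<inter> side v (int j)) \<longrightarrow>
      (\<exists>\<alpha>>0. L ! Suc i - L ! i = \<alpha> *\<^sub>R side_shift v (int j)))" (is "_ \<longleftrightarrow> ?mid")
    unfolding oriented_along_def
  proof (intro iff_allI)
    fix i j
    show "(Suc i < length L \<and> Suc j < length (cycle_list n v) \<and>
        (\<exists>p q. p \<noteq> q \<and> {p, q} \<subseteq> edge L i \<inter> edge (cycle_list n v) j) \<longrightarrow>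
        (\<exists>\<alpha>>0. L ! Suc i - L ! i = \<alpha> *\<^sub>R (cycle_list n v ! Suc j - cycle_list n v ! j))) \<longleftrightarrow>
      (Suc i < length L \<and> j < n \<and> (\<exists>p q. p \<noteq> q \<and> {p, q} \<subseteq> edge L i \<inter> side v (int j)) \<longrightarrow>
        (\<exists>\<alpha>>0. L ! Suc i - L ! i = \<alpha> *\<^sub>R side_shift v (int j)))"
      by (cases "j < n") (simp_all add: edge_cycle_list sh)
  qed
  also have "?mid \<longleftrightarrow> ?rhs"
  proof
    assume m: ?mid
    show ?rhs
    proof (intro allI impI)
      fix i j assume a: "Suc i < length L \<and> (\<exists>p q. p \<noteq> q \<and> {p, q} \<subseteq> edge L i \<inter> side v j)"
      have "int (nat (j mod int n)) = j mod int n" "nat (j mod int n) < n"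
        using n3 by (auto simp: nat_less_iff)
      then show "\<exists>\<alpha>>0. L ! Suc i - L ! i = \<alpha> *\<^sub>R side_shift v j"
        using m[rule_format, of i "nat (j mod int n)"] a
        by (simp add: simple_cycle_side_mod[OF v] simple_cycle_side_shift_mod[OF v])
    qed
  qed auto
  finally show ?thesis .
qed

lemma infinite_closed_segment_Diff:
  fixes a b :: complex
  assumes "a \<noteq> b" "z \<in> closed_segment a b" "closed D" "z \<notin> D"
  shows "infinite (closed_segment a b - D)"
proof -
  have "closed_segment a b \<noteq> {x}" for x using assms(1) by (metis ends_in_segment singletonD)
  then have "z islimpt closed_segment a b" using assms by (intro connected_imp_perfect) auto
  then have "infinite (- D \<inter> closed_segment a b)"
    using assms unfolding islimpt_eq_acc_point by auto
  then show ?thesis by (simp add: Diff_eq Int_commute)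
qed

text \<open>Near \<open>z\<close> the edge has infinitely many points outside \<open>D\<close>, and
  finitely many sides cover them, so one side contains two of them and \<open>oriented_along\<close>
  fixes the direction. The set \<open>D\<close> steers the choice: empty, it allows any side; as the
  union of the sides missing \<open>z\<close>, it forces a side through \<open>z\<close>.\<close>

lemma sub_polyline_shift_along_side:
  assumes v: "simple_cycle n v"
    and L: "polyline L" "polyline_set L \<subseteq> (\<Union>i. side v i)" "oriented_along L (cycle_list n v)"
    and i: "Suc i < length L" and z: "z \<in> edge L i" and D: "closed D" "z \<notin> D"
  shows "\<exists>j\<in>{0..<int n}. \<exists>\<alpha>>0. L ! Suc i - L ! i = \<alpha> *\<^sub>R side_shift v j \<and> \<not> side v j \<subseteq> D"
proof -
  have n3: "3 \<le> n" by (rule simple_cycle_ge3[OF v])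
  have "L ! i \<noteq> L ! Suc i" using L(1) i by (simp add: polyline_def distinct_adj_conv_nth)
  then have inf: "infinite (edge L i - D)"
    unfolding edge_def using z D by (intro infinite_closed_segment_Diff) (auto simp: edge_def)
  have "edge L i \<subseteq> polyline_set L" unfolding polyline_set_def using i by (intro UN_upper) simp
  moreover have "(\<Union>i. side v i) \<subseteq> (\<Union>j\<in>{0..<int n}. side v j)"
  proof (intro UN_least)
    fix j
    have "j mod int n \<in> {0..<int n}" using n3 by auto
    then have "side v (j mod int n) \<subseteq> (\<Union>j\<in>{0..<int n}. side v j)" by (rule UN_upper)
    then show "side v j \<subseteq> (\<Union>j\<in>{0..<int n}. side v j)" unfolding simple_cycle_side_mod[OF v] .
  qed
  ultimately have "edge L i \<subseteq> (\<Union>j\<in>{0..<int n}. side v j)" using L(2) by (meson order_trans)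
  then have "edge L i - D \<subseteq> (\<Union>j\<in>{0..<int n}. (edge L i - D) \<inter> side v j)" by auto
  then have "infinite (\<Union>j\<in>{0..<int n}. (edge L i - D) \<inter> side v j)" using inf finite_subset by blast
  then obtain j where j: "j \<in> {0..<int n}" "infinite ((edge L i - D) \<inter> side v j)"
    using finite_UN_I[of "{0..<int n}" "\<lambda>j. (edge L i - D) \<inter> side v j"] by blast
  obtain p where p: "p \<in> (edge L i - D) \<inter> side v j" using infinite_imp_nonempty[OF j(2)] by blast
  obtain q where q: "q \<in> (edge L i - D) \<inter> side v j" "q \<noteq> p"
  proof -
    have "infinite ((edge L i - D) \<inter> side v j - {p})" using j(2) by simp
    then obtain q where "q \<in> (edge L i - D) \<inter> side v j - {p}"
      using infinite_imp_nonempty by blast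
    then show ?thesis using that by blast
  qed
  have "\<exists>\<alpha>>0. L ! Suc i - L ! i = \<alpha> *\<^sub>R side_shift v j"
    by (rule L(3)[unfolded oriented_along_cycle_list[OF v], rule_format])
      (intro conjI i exI[of _ p] exI[of _ q], use p q in auto)
  then show ?thesis using j(1) p by blast
qed

text \<open>A point that is not a vertex lies on one side only, so the edges of \<open>L\<close>
  before and after it have the direction of that same side.\<close>

lemma sub_polyline_turn_at_vertex:
  assumes v: "simple_cycle n v"
    and L: "polyline L" "polyline_set L \<subseteq> (\<Union>i. side v i)" "oriented_along L (cycle_list n v)"
    and i: "Suc (Suc i) < length L"
    and turn: "signed_angle (L ! Suc i - L ! i) (L ! Suc (Suc i) - L ! Suc i) \<noteq> 0"
  shows "L ! Suc i \<in> v ` {0..<int n}"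
proof (rule ccontr)
  assume nv: "L ! Suc i \<notin> v ` {0..<int n}"
  define z where "z = L ! Suc i"
  have n3: "3 \<le> n" by (rule simple_cycle_ge3[OF v])
  have nv': "z \<noteq> v k" for k
  proof -
    have "v k = v (k mod int n)" "k mod int n \<in> {0..<int n}"
      using simple_cycle_mod[OF v, of k] n3 by auto
    then show ?thesis using nv by (auto simp: z_def)
  qed
  \<comment> \<open>The union of the sides that miss \<open>z\<close>. It is closed, being a finite
    union of segments.\<close>
  define D where "D = (\<Union>j\<in>{j\<in>{0..<int n}. z \<notin> side v j}. side v j)"
  have "finite {j \<in> {0..<int n}. z \<notin> side v j}"
    by (rule finite_subset[of _ "{0..<int n}"]) auto
  then have "closed D" unfolding D_def by (intro closed_UN) (auto simp: side_def)
  moreover have "z \<notin> D" by (auto simp: D_def)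
  ultimately have D: "closed D" "z \<notin> D" .
  have "z \<in> edge L i" "z \<in> edge L (Suc i)" by (auto simp: z_def edge_def)
  then obtain j \<alpha> k \<beta> where j: "j \<in> {0..<int n}" "\<alpha> > 0" "L ! Suc i - L ! i = \<alpha> *\<^sub>R side_shift v j" "\<not> side v j \<subseteq> D"
    and k: "k \<in> {0..<int n}" "\<beta> > 0" "L ! Suc (Suc i) - L ! Suc i = \<beta> *\<^sub>R side_shift v k" "\<not> side v k \<subseteq> D"
    using sub_polyline_shift_along_side[OF v L _ _ D, of i] sub_polyline_shift_along_side[OF v L _ _ D, of "Suc i"] i
    by (metis Suc_lessD)
  have "z \<in> side v j" "z \<in> side v k" using j k by (auto simp: D_def)
  then have "j mod int n = k mod int n" using sides_Int_subset_vertex[OF v, of j k] nv' by blast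
  then have "j = k" using j(1) k(1) by auto
  then have "signed_angle (L ! Suc i - L ! i) (L ! Suc (Suc i) - L ! Suc i) = 0"
    using j(2,3) k(2,3) signed_angle_scale signed_angle_self by metis
  then show False using turn by simp
qed

section \<open>Finiteness of the set of rotations of sub-arcs\<close>

lemma rot_eq:
  "rot L = (\<Sum>i<length L - 2. signed_angle (L ! Suc i - L ! i) (L ! Suc (Suc i) - L ! Suc i))"
  unfolding rot_def Let_def by (rule sum.cong) (auto simp: shifts_def)

lemma simple_polyline_nth_neq:
  assumes "simple_polyline L" "i < j" "Suc j < length L"
  shows "L ! i \<noteq> L ! j"
proof (cases "j = Suc i")
  case True
  then show ?thesis using assms by (auto simp: simple_polyline_def polyline_def distinct_adj_conv_nth)
next
  case False
  then have "edge L i \<inter> edge L j = {}" using assms by (auto simp: simple_polyline_def)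
  moreover have "L ! i \<in> edge L i" "L ! j \<in> edge L j" by (auto simp: edge_def)
  ultimately show ?thesis by auto
qed

text \<open>\<open>Min\<close> is a lower bound only on a finite set, so every later use of
  \<open>aco_boundary\<close> rests on this. Each rotation is encoded as the sum of a function from
  the finite set \<open>V\<close> of vertices to the finite set \<open>A\<close> of possible
  turns.\<close>

lemma finite_sub_polyline_rots:
  assumes v: "simple_cycle n v"
  shows "finite {rot L | L. simple_polyline L \<and> polyline_set L \<subseteq> polyline_set (cycle_list n v) \<and>
     oriented_along L (cycle_list n v)}"
proof -
  define V where "V = v ` {0..<int n}"
  define A where "A = insert 0 ((\<lambda>(j, k). signed_angle (side_shift v j) (side_shift v k)) ` ({0..<int n} \<times> {0..<int n}))"
  have "rot L \<in> (\<lambda>g. \<Sum>p\<in>V. g p) ` (V \<rightarrow>\<^sub>E A)"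
    if S: "simple_polyline L" and L2: "polyline_set L \<subseteq> (\<Union>i. side v i)"
      and L3: "oriented_along L (cycle_list n v)" for L
  proof -
    have L1: "polyline L" using S by (simp add: simple_polyline_def)
    define f where "f i = signed_angle (L ! Suc i - L ! i) (L ! Suc (Suc i) - L ! Suc i)" for i
    define I where "I = {i. i < length L - 2 \<and> f i \<noteq> 0}"
    define c where "c i = L ! Suc i" for i
    have inj: "inj_on c I"
    proof (rule linorder_inj_onI)
      fix x y assume xy: "x < y" "x \<in> I" "y \<in> I"
      then have "Suc (Suc y) < length L" by (auto simp: I_def)
      then show "c x \<noteq> c y" using xy simple_polyline_nth_neq[OF S, of "Suc x" "Suc y"] by (simp add: c_def)
    qed auto
    have cV: "c ` I \<subseteq> V"
      using sub_polyline_turn_at_vertex[OF v L1 L2 L3] by (auto simp: V_def I_def c_def f_def)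
    have fA: "f i \<in> A" if "i \<in> I" for i
    proof -
      have i: "Suc i < length L" "Suc (Suc i) < length L" using that by (auto simp: I_def)
      have "L ! i \<in> edge L i" "L ! Suc i \<in> edge L (Suc i)" by (auto simp: edge_def)
      then obtain j \<alpha> k \<beta> where "j \<in> {0..<int n}" "\<alpha> > 0" "L ! Suc i - L ! i = \<alpha> *\<^sub>R side_shift v j"
        and "k \<in> {0..<int n}" "\<beta> > 0" "L ! Suc (Suc i) - L ! Suc i = \<beta> *\<^sub>R side_shift v k"
        using sub_polyline_shift_along_side[OF v L1 L2 L3 i(1) _ closed_empty]
          sub_polyline_shift_along_side[OF v L1 L2 L3 i(2) _ closed_empty]
        by (metis empty_iff)
      then have "f i = signed_angle (side_shift v j) (side_shift v k)" "(j, k) \<in> {0..<int n} \<times> {0..<int n}"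
        by (auto simp: f_def signed_angle_scale)
      then show ?thesis unfolding A_def by force
    qed
    \<comment> \<open>The vertices at which \<open>L\<close> turns are pairwise distinct points, so
      its nonzero turns can be indexed by them; all other vertices receive 0, which is why 0 was put
      into \<open>A\<close>.\<close>
    define g where "g = restrict (\<lambda>p. if p \<in> c ` I then f (the_inv_into I c p) else 0) V"
    have "0 \<in> A" by (simp add: A_def)
    then have "g \<in> V \<rightarrow>\<^sub>E A"
      using fA inj by (auto simp: g_def the_inv_into_f_f)
    moreover have "rot L = (\<Sum>p\<in>V. g p)"
    proof -
      have "rot L = (\<Sum>i\<in>I. f i)"
        unfolding rot_eq f_def[symmetric] by (rule sum.mono_neutral_right) (auto simp: I_def)
      also have "\<dots> = (\<Sum>p\<in>c ` I. f (the_inv_into I c p))"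
        using inj by (subst sum.reindex) (auto simp: the_inv_into_f_f)
      also have "\<dots> = (\<Sum>p\<in>V. if p \<in> c ` I then f (the_inv_into I c p) else 0)"
        using cV by (intro sum.mono_neutral_cong_left) (auto simp: V_def)
      finally show ?thesis by (simp add: g_def)
    qed
    ultimately show ?thesis by blast
  qed
  then have "{rot L | L. simple_polyline L \<and> polyline_set L \<subseteq> polyline_set (cycle_list n v) \<and>
     oriented_along L (cycle_list n v)} \<subseteq> (\<lambda>g. \<Sum>p\<in>V. g p) ` (V \<rightarrow>\<^sub>E A)"
    unfolding polyline_set_cycle_list[OF v] by auto
  moreover have "finite ((\<lambda>g. \<Sum>p\<in>V. g p) ` (V \<rightarrow>\<^sub>E A))"
    by (intro finite_imageI finite_PiE) (auto simp: V_def A_def)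
  ultimately show ?thesis by (rule finite_subset)
qed

text \<open>This is the form in which sub-arcs are tested against the minimum: inner joints are
  vertices of the cycle, while both ends may lie inside a side. Because \<open>m < n\<close>, some
  side is left out, and the ends of the chain do not meet around the cycle.\<close>

lemma aco_boundary_le_rot_chain:
  assumes v: "simple_cycle n v" and m: "1 \<le> m" "m < n"
    and sub: "\<And>k. k < m \<Longrightarrow> closed_segment (l k) (l (Suc k)) \<subseteq> side v (i + int k)"
    and joint: "\<And>k. Suc k < m \<Longrightarrow> l (Suc k) = v (i + int k + 1)"
    and dir: "\<And>k. k < m \<Longrightarrow> \<exists>\<alpha>>0. l (Suc k) - l k = \<alpha> *\<^sub>R side_shift v (i + int k)"
  shows "aco_boundary (cycle_list n v) \<le>
    (\<Sum>k<m - 1. signed_angle (l (Suc k) - l k) (l (Suc (Suc k)) - l (Suc k)))"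
proof -
  define L where "L = map l [0..<Suc m]"
  have len: "length L = Suc m" by (simp add: L_def)
  have nth: "L ! k = l k" if "k \<le> m" for k
    unfolding L_def using that by (subst nth_map) (auto simp del: upt_Suc)
  have e: "edge L k = closed_segment (l k) (l (Suc k))" if "k < m" for k
    using that by (simp add: edge_def nth)
  have ne: "l k \<noteq> l (Suc k)" if "k < m" for k
    using dir[OF that] simple_cycle_neq[OF v, of "i + int k"] by (auto simp: side_shift_def)
  have "distinct_adj L" unfolding distinct_adj_conv_nth using ne by (simp add: len nth)
  then have "polyline L" using m by (simp add: polyline_def len)
  moreover have "edge L k \<inter> edge L (Suc k) = {L ! Suc k}" if "k + 2 < length L" for k
  proof -
    have k: "Suc k < m" "k < m" "Suc k \<le> m" using that len by auto
    have "edge L k \<inter> edge L (Suc k) \<subseteq> side v (i + int k) \<inter> side v (i + int k + 1)"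
      using sub[of k] sub[of "Suc k"] k by (auto simp: e algebra_simps)
    also have "\<dots> = {l (Suc k)}" using simple_cycle_adj[OF v] joint[OF k(1)] by simp
    finally show ?thesis unfolding e[OF k(1)] e[OF k(2)] nth[OF k(3)] by auto
  qed
  moreover have "edge L k \<inter> edge L k' = {}" if "Suc k < k' \<and> Suc k' < length L" for k k'
  proof -
    have k: "Suc k < k'" "k' < m" "k < m" using that len by auto
    then have "side v (i + int k) \<inter> side v (i + int k') = {}"
      using m by (intro simple_cycle_disjoint[OF v]) auto
    then show ?thesis using sub[of k] sub[of k'] k by (auto simp: e)
  qed
  ultimately have simple: "simple_polyline L" unfolding simple_polyline_def by blast
  have "polyline_set L \<subseteq> (\<Union>i. side v i)"
    unfolding polyline_set_def using sub len e by fastforce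
  then have set: "polyline_set L \<subseteq> polyline_set (cycle_list n v)"
    by (simp add: polyline_set_cycle_list[OF v])
  have orient: "oriented_along L (cycle_list n v)"
    unfolding oriented_along_cycle_list[OF v]
  proof (intro allI impI)
    fix k j assume kj: "Suc k < length L \<and> (\<exists>p q. p \<noteq> q \<and> {p, q} \<subseteq> edge L k \<inter> side v j)"
    then have k: "k < m" using len by auto
    obtain p q where pq: "p \<noteq> q" "{p, q} \<subseteq> edge L k \<inter> side v j" using kj by blast
    then have "{p, q} \<subseteq> side v (i + int k) \<inter> side v j" using sub[OF k] e[OF k] by auto
    then have "(i + int k) mod int n = j mod int n"
      using sides_Int_subset_vertex[OF v, of "i + int k" j] pq(1) by blast
    then have "side_shift v (i + int k) = side_shift v j"
      using simple_cycle_side_shift_mod[OF v] by metis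
    then show "\<exists>\<alpha>>0. L ! Suc k - L ! k = \<alpha> *\<^sub>R side_shift v j"
      using dir[OF k] k by (simp add: nth)
  qed
  have "rot L = (\<Sum>k<m - 1. signed_angle (l (Suc k) - l k) (l (Suc (Suc k)) - l (Suc k)))"
    unfolding rot_eq len by (rule sum.cong) (auto simp: nth)
  moreover have "aco_boundary (cycle_list n v) \<le> rot L"
    unfolding aco_boundary_def using simple set orient
    by (intro Min_le finite_sub_polyline_rots[OF v]) blast
  ultimately show ?thesis by simp
qed

text \<open>A single side is an admissible arc without any turn.\<close>

lemma aco_boundary_nonpos:
  assumes v: "simple_cycle n v"
  shows "aco_boundary (cycle_list n v) \<le> 0"
proof -
  have "aco_boundary (cycle_list n v) \<le>
    (\<Sum>k<1 - 1. signed_angle (v (int (Suc k)) - v (int k)) (v (int (Suc (Suc k))) - v (int (Suc k))))"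
    using simple_cycle_ge3[OF v]
    by (intro aco_boundary_le_rot_chain[OF v, where i = 0])
      (auto simp: side_def side_shift_def intro: exI[of _ 1])
  then show ?thesis by simp
qed

subsection \<open>Arguments as seen from a point\<close>

lemma cis_eq_imp_eq:
  assumes "cis s = cis t" "\<bar>s - t\<bar> < 2 * pi"
  shows "s = t"
proof -
  have "cis (s - t) = 1" using assms(1) by (simp flip: cis_divide)
  then have "Re (cis (s - t)) = 1" by simp
  then have "cos (s - t) = 1" by simp
  then obtain k :: int where k: "s - t = of_int k * 2 * pi" by (auto simp: cos_one_2pi_int)
  have "\<bar>of_int k * (2 * pi)\<bar> < 1 * (2 * pi)" using assms(2) k by simp
  then have "\<bar>of_int k :: real\<bar> < 1" by (simp add: abs_mult)
  then have "k = 0" by linarith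
  then show ?thesis using k by simp
qed

lemma scaled_cis_eq_imp_eq:
  assumes "a *\<^sub>R cis s = b *\<^sub>R cis t" "0 < a" "0 < b" "\<bar>s - t\<bar> < 2 * pi"
  shows "s = t"
proof -
  have "norm (a *\<^sub>R cis s) = norm (b *\<^sub>R cis t)" using assms(1) by simp
  then have "a = b" using assms(2,3) by (simp only: norm_scaleR norm_cis)
  then show ?thesis using assms cis_eq_imp_eq by auto
qed

definition argument_on :: "complex set \<Rightarrow> complex \<Rightarrow> (complex \<Rightarrow> real) \<Rightarrow> bool" where
  "argument_on S x \<theta> \<longleftrightarrow> x \<notin> S \<and> continuous_on S \<theta> \<and>
     (\<forall>z\<in>S. z - x = norm (z - x) *\<^sub>R cis (\<theta> z))"

lemma argument_on_subset: "argument_on S x \<theta> \<Longrightarrow> T \<subseteq> S \<Longrightarrow> argument_on T x \<theta>"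
  unfolding argument_on_def using continuous_on_subset by blast

lemma quotient_nonpos_imp_in_segment:
  fixes a z x :: complex
  assumes "a \<noteq> x" "(z - x) / (a - x) \<in> \<real>\<^sub>\<le>\<^sub>0"
  shows "x \<in> closed_segment a z"
proof -
  have "0 \<in> closed_segment (a - x) (z - x)"
    using zero_in_segment_imp_nonpos[of "a - x" "z - x"] assms by simp
  then obtain t where t: "0 \<le> t" "t \<le> 1" "0 = (1 - t) *\<^sub>R (a - x) + t *\<^sub>R (z - x)"
    unfolding in_segment by auto
  then have "x = (1 - t) *\<^sub>R a + t *\<^sub>R z" by (simp add: algebra_simps)
  then show ?thesis unfolding in_segment using t by blast
qed

text \<open>Both \<theta> and the branch based at \<open>a\<close> are continuous arguments on the
  segment. Their difference takes values at least \<open>2 * pi\<close> apart unless equal, hence is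
  constant on a connected set.\<close>

lemma argument_on_segment:
  assumes \<theta>: "argument_on (closed_segment a b) x \<theta>" and z: "z \<in> closed_segment a b"
  shows "\<theta> z = \<theta> a + Arg ((z - x) / (a - x))"
proof -
  have x: "x \<notin> closed_segment a b" and cont: "continuous_on (closed_segment a b) \<theta>"
    and eq: "\<And>z. z \<in> closed_segment a b \<Longrightarrow> z - x = norm (z - x) *\<^sub>R cis (\<theta> z)"
    using \<theta> by (auto simp: argument_on_def)
  have ax: "a \<noteq> x" using x by auto
  have np: "(z - x) / (a - x) \<notin> \<real>\<^sub>\<le>\<^sub>0" if "z \<in> closed_segment a b" for z
    using quotient_nonpos_imp_in_segment[OF ax, of z] that x subset_closed_segment[of a z a b] by auto
  define \<phi> where "\<phi> z = \<theta> z - Arg ((z - x) / (a - x))" for z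
  have cis\<phi>: "cis (\<phi> z) = cis (\<theta> a)" if z: "z \<in> closed_segment a b" for z
  proof -
    have zx: "z \<noteq> x" using z x by auto
    define q where "q = (z - x) / (a - x)"
    have q: "q \<noteq> 0" using zx ax by (simp add: q_def)
    have "(z - x) = q * (a - x)" using ax by (simp add: q_def)
    then have "norm (z - x) *\<^sub>R cis (\<theta> z) = (norm q *\<^sub>R cis (Arg q)) * (norm (a - x) *\<^sub>R cis (\<theta> a))"
      using eq[OF z] eq[of a] rcis_cmod_Arg[of q] by (simp add: rcis_def scaleR_conv_of_real)
    also have "\<dots> = norm (z - x) *\<^sub>R (cis (Arg q) * cis (\<theta> a))"
      using ax by (simp add: q_def norm_divide)
    finally have "cis (\<theta> z) = cis (Arg q) * cis (\<theta> a)" using zx by simp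
    then show ?thesis unfolding \<phi>_def q_def[symmetric] by (simp flip: cis_divide)
  qed
  have "\<phi> constant_on closed_segment a b"
  proof (rule continuous_discrete_range_constant)
    show "continuous_on (closed_segment a b) \<phi>"
      unfolding \<phi>_def using np ax by (intro continuous_intros cont) auto
    fix y
    assume y: "y \<in> closed_segment a b"
    have "2 * pi \<le> norm (\<phi> z - \<phi> y)" if "z \<in> closed_segment a b \<and> \<phi> z \<noteq> \<phi> y" for z
      using cis_eq_imp_eq[of "\<phi> z" "\<phi> y"] cis\<phi>[of z] cis\<phi>[of y] y that by force
    then show "\<exists>e>0. \<forall>z. z \<in> closed_segment a b \<and> \<phi> z \<noteq> \<phi> y \<longrightarrow> e \<le> norm (\<phi> z - \<phi> y)"
      by (intro exI[of _ "2 * pi"]) auto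
  qed auto
  then have "\<phi> z = \<phi> a" using z unfolding constant_on_def by (metis ends_in_segment(1))
  then show ?thesis using ax by (simp add: \<phi>_def)
qed

lemma argument_on_segment_lt_pi:
  assumes \<theta>: "argument_on (closed_segment a b) x \<theta>"
  shows "\<bar>\<theta> b - \<theta> a\<bar> < pi"
proof -
  have ax: "a \<noteq> x" and x: "x \<notin> closed_segment a b" using \<theta> by (auto simp: argument_on_def)
  have "Arg ((b - x) / (a - x)) \<noteq> pi"
    using quotient_nonpos_imp_in_segment[OF ax, of b] x by (auto simp: Arg_eq_pi complex_nonpos_Reals_iff)
  then show ?thesis
    using argument_on_segment[OF \<theta>, of b] mpi_less_Arg[of "(b - x) / (a - x)"]
      Arg_le_pi[of "(b - x) / (a - x)"] by auto
qed

text \<open>With \<open>c\<close> the cross product of the two ends seen from \<open>x\<close>, the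
  cross products of \<open>a - x\<close> and \<open>b - x\<close> with \<open>z - x\<close> are
  \<open>t * c\<close> and \<open>- ((1 - t) * c)\<close>. Their opposite signs place \<theta> at
  \<open>z\<close> between the values at the ends, so extreme values occur at vertices.\<close>

lemma argument_on_segment_le:
  assumes \<theta>: "argument_on (closed_segment a b) x \<theta>" and z: "z \<in> closed_segment a b"
  shows "\<theta> z \<le> max (\<theta> a) (\<theta> b) \<and> min (\<theta> a) (\<theta> b) \<le> \<theta> z"
proof -
  have x: "x \<notin> closed_segment a b" and ax: "a \<noteq> x" and bx: "b \<noteq> x"
    using \<theta> by (auto simp: argument_on_def)
  have \<theta>': "argument_on (closed_segment b a) x \<theta>" using \<theta> by (simp add: closed_segment_commute)
  have z': "z \<in> closed_segment b a" using z by (simp add: closed_segment_commute)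
  have sgn: "(Arg q \<ge> 0 \<longleftrightarrow> Im q \<ge> 0) \<and> (Im q \<le> 0 \<longrightarrow> Arg q \<le> 0)"
    if "q = (z - x) / (a - x) \<or> q = (z - x) / (b - x)" for q
  proof -
    have "q \<notin> \<real>\<^sub>\<le>\<^sub>0"
      using quotient_nonpos_imp_in_segment[OF ax, of z] quotient_nonpos_imp_in_segment[OF bx, of z]
        that x z z' subset_closed_segment[of a z a b] subset_closed_segment[of b z b a]
      by (auto simp: closed_segment_commute)
    then show ?thesis
      using Arg_less_0[of q] Arg_lt_pi[of q] Arg_pos_iff[of q] by (auto simp: complex_nonpos_Reals_iff)
  qed
  obtain t where t: "0 \<le> t" "t \<le> 1" "z = (1 - t) *\<^sub>R a + t *\<^sub>R b" using z unfolding in_segment by auto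
  define c where "c = cross (a - x) (b - x)"
  have zx: "z - x = (1 - t) *\<^sub>R (a - x) + t *\<^sub>R (b - x)" using t(3) by (simp add: algebra_simps)
  have Im_div: "Im (p / q) = cross q p / (norm q)\<^sup>2" for p q
    by (simp add: Im_divide cross_def cmod_power2 algebra_simps)
  have "cross (a - x) (z - x) = t * c" "cross (b - x) (z - x) = - ((1 - t) * c)"
    unfolding zx c_def by (auto simp: cross_def algebra_simps)
  then have im: "Im ((z - x) / (a - x)) = t * c / (norm (a - x))\<^sup>2"
    "Im ((z - x) / (b - x)) = - ((1 - t) * c / (norm (b - x))\<^sup>2)"
    unfolding Im_div by auto
  have e: "\<theta> z = \<theta> a + Arg ((z - x) / (a - x))" "\<theta> z = \<theta> b + Arg ((z - x) / (b - x))"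
    using argument_on_segment[OF \<theta> z] argument_on_segment[OF \<theta>' z'] by auto
  show ?thesis
  proof (cases "c \<ge> 0")
    case True
    then have "Im ((z - x) / (a - x)) \<ge> 0" "Im ((z - x) / (b - x)) \<le> 0" using im t by auto
    then show ?thesis using sgn e by fastforce
  next
    case False
    then have "Im ((z - x) / (a - x)) \<le> 0" "Im ((z - x) / (b - x)) \<ge> 0"
      using im t by (auto simp: divide_le_0_iff mult_le_0_iff)
    then show ?thesis using sgn e by fastforce
  qed
qed

text \<open>These strict signs decide the signs of the boundary terms \<open>B 1\<close> and
  \<open>E (N - 1)\<close> of an arc that crosses a sector.\<close>

lemma argument_on_segment_decreasing:
  assumes \<theta>: "argument_on (closed_segment a b) x \<theta>" and "\<theta> b < \<theta> a"
  shows "Im ((b - x) / (a - x)) < 0" "Im ((a - x) / (b - x)) > 0"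
proof -
  have \<theta>': "argument_on (closed_segment b a) x \<theta>" using \<theta> by (simp add: closed_segment_commute)
  have "Arg ((b - x) / (a - x)) < 0" using argument_on_segment[OF \<theta>, of b] assms by auto
  then show "Im ((b - x) / (a - x)) < 0" using Arg_neg_iff by simp
  have "Arg ((a - x) / (b - x)) > 0" using argument_on_segment[OF \<theta>', of a] assms by auto
  moreover have "Arg ((a - x) / (b - x)) < pi"
    using argument_on_segment_lt_pi[OF \<theta>'] argument_on_segment[OF \<theta>', of a] by auto
  ultimately show "Im ((a - x) / (b - x)) > 0" using Arg_lt_pi by auto
qed

subsection \<open>Polylines crossing a sector clockwise\<close>

text \<open>
  Hopf's formula reduces the rotation to the variation of two arguments, that of \<open>l k - l 0\<close>, whose
  branch cut is the ray of the sector through \<open>l 0\<close>, and that of \<open>l N - l k\<close>, whose branch cut is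
  opposite to the ray through \<open>l N\<close>. The two branches differ by \<open>\<alpha>\<close> at the common direction
  \<open>l N - l 0\<close>.
\<close>

lemma rot_clockwise_sector:
  fixes l :: "nat \<Rightarrow> complex"
  assumes ne: "\<And>i. i < N \<Longrightarrow> l i \<noteq> l (Suc i)"
    and adj: "\<And>i. Suc i < N \<Longrightarrow>
      closed_segment (l i) (l (Suc i)) \<inter> closed_segment (l (Suc i)) (l (Suc (Suc i))) = {l (Suc i)}"
    and dis: "\<And>i j. \<lbrakk>Suc i < j; j < N\<rbrakk> \<Longrightarrow>
      closed_segment (l i) (l (Suc i)) \<inter> closed_segment (l j) (l (Suc j)) = {}"
    and N: "2 \<le> N"
    and arg: "argument_on (\<Union>i<N. closed_segment (l i) (l (Suc i))) x \<theta>"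
    and al: "0 \<le> \<alpha>" "\<alpha> < pi" and ends: "\<theta> (l N) = \<theta> (l 0) - (pi + \<alpha>)"
    and inner: "\<And>i. 0 < i \<Longrightarrow> i < N \<Longrightarrow> \<theta> (l N) < \<theta> (l i) \<and> \<theta> (l i) < \<theta> (l 0)"
  shows "(\<Sum>i<N - 1. signed_angle (l (Suc i) - l i) (l (Suc (Suc i)) - l (Suc i))) < - \<alpha>"
proof -
  define M where "M = \<theta> (l 0)"
  define m where "m = \<theta> (l N)"
  have Mm: "m = M - (pi + \<alpha>)" "m < M" using ends al by (auto simp: M_def m_def)
  have seg: "argument_on (closed_segment (l i) (l (Suc i))) x \<theta>" if "i < N" for i
    using argument_on_subset[OF arg] that by (metis UN_upper lessThan_iff)
  have lx: "z - x = norm (z - x) *\<^sub>R cis (\<theta> z)" "z \<noteq> x" if "i < N" "z \<in> closed_segment (l i) (l (Suc i))" for i z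
    using seg[OF that(1)] that(2) by (auto simp: argument_on_def)
  define r0 where "r0 = norm (l 0 - x)"
  define rN where "rN = norm (l N - x)"
  define u where "u = cis M"
  define w where "w = cis m"
  have l0: "l 0 - x = r0 *\<^sub>R u" "r0 > 0" using lx[of 0 "l 0"] N by (auto simp: r0_def u_def M_def)
  have lN: "l N - x = rN *\<^sub>R w" "rN > 0"
    using lx[of "N - 1" "l N"] N by (auto simp: rN_def w_def m_def)
  have uw: "u \<noteq> 0" "w \<noteq> 0" by (auto simp: u_def w_def)
  have w_eq: "w = - (u * cis (- \<alpha>))"
    unfolding w_def u_def Mm(1) cis_mult by (simp add: complex_eq_iff cos_diff sin_diff cos_add sin_add)
  have bnd: "\<theta> z \<le> M" "m \<le> \<theta> z" "0 < i \<Longrightarrow> \<theta> z < M" "Suc i < N \<Longrightarrow> m < \<theta> z"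
    if "i < N" "z \<in> closed_segment (l i) (l (Suc i))" for i z
  proof -
    have le: "\<theta> z \<le> max (\<theta> (l i)) (\<theta> (l (Suc i)))" "min (\<theta> (l i)) (\<theta> (l (Suc i))) \<le> \<theta> z"
      using argument_on_segment_le[OF seg[OF that(1)] that(2)] by auto
    have *: "\<theta> (l k) \<le> M" "m \<le> \<theta> (l k)" "0 < k \<Longrightarrow> \<theta> (l k) < M" "k < N \<Longrightarrow> m < \<theta> (l k)" if "k \<le> N" for k
      using inner[of k] that Mm(2) unfolding M_def m_def by (cases "k = 0"; cases "k = N"; auto)+
    show "\<theta> z \<le> M" "m \<le> \<theta> z" using le *(1,2)[of i] *(1,2)[of "Suc i"] that(1) by auto
    show "\<theta> z < M" if "0 < i" using le(1) *(3)[of i] *(3)[of "Suc i"] that \<open>i < N\<close> by auto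
    show "m < \<theta> z" if "Suc i < N" using le(2) *(4)[of i] *(4)[of "Suc i"] that by auto
  qed
  define B where "B j = Arg ((l j - l 0) / (- u))" for j
  define E where "E i = Arg ((l N - l i) / w)" for i
  have segdiff: "\<exists>z\<in>closed_segment a b. p = z - c" if "p \<in> closed_segment (a - c) (b - c)" for a b c p :: complex
    using that closed_segment_translation[of "- c" a b] by auto
  have segdiff': "\<exists>z\<in>closed_segment a b. p = c - z" if "p \<in> closed_segment (c - a) (c - b)" for a b c p :: complex
  proof -
    have "- p \<in> closed_segment (a - c) (b - c)"
      using that closed_segment_linear_image[OF linear_uminus, of "c - a" "c - b"] by auto
    then show ?thesis using segdiff[of "- p" a c b] by (metis minus_diff_eq minus_minus)
  qed
  have first: "signed_angle (l j - l 0) (l (Suc j) - l 0) = B (Suc j) - B j" if j: "0 < j" "j < N" for j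
    unfolding B_def
  proof (rule signed_angle_eq_diff)
    fix p assume "p \<in> closed_segment (l j - l 0) (l (Suc j) - l 0)"
    then obtain z where z: "z \<in> closed_segment (l j) (l (Suc j))" "p = z - l 0" using segdiff by blast
    show "p / (- u) \<notin> \<real>\<^sub>\<le>\<^sub>0"
    proof
      assume "p / (- u) \<in> \<real>\<^sub>\<le>\<^sub>0"
      then obtain r where r: "r \<le> 0" "p / (- u) = of_real r"
        unfolding nonpos_Reals_def by blast
      have "- u \<noteq> 0" using uw by simp
      from r(2)[unfolded nonzero_divide_eq_eq[OF this]] have "p = - r *\<^sub>R u"
        by (simp add: scaleR_conv_of_real)
      then have "z - x = (r0 - r) *\<^sub>R cis M"
        using z(2) l0(1) by (simp add: algebra_simps u_def)
      then have "norm (z - x) *\<^sub>R cis (\<theta> z) = (r0 - r) *\<^sub>R cis M" using lx[OF j(2) z(1)] by simp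
      moreover have "norm (z - x) > 0" using lx[OF j(2) z(1)] by simp
      \<comment> \<open>A secant on the cut ends on the ray beyond \<open>l 0\<close>, where
        \<theta> is \<open>M\<close> up to multiples of \<open>2 * pi\<close>. On the arc \<theta>
        stays within \<open>pi + \<alpha> < 2 * pi\<close> of \<open>M\<close>, so it equals
        \<open>M\<close>; edges after the first exclude this.\<close>
      ultimately have "\<theta> z = M"
        using scaled_cis_eq_imp_eq[of "norm (z - x)" "\<theta> z" "r0 - r" M] bnd[OF j(2) z(1)] r(1) l0(2) Mm al by auto
      then show False using bnd(3)[OF j(2) z(1)] j(1) by simp
    qed
  qed (use uw in auto)
  have second: "signed_angle (l N - l i) (l N - l (Suc i)) = E (Suc i) - E i" if i: "Suc i < N" for i
    unfolding E_def
  proof (rule signed_angle_eq_diff)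
    fix p assume "p \<in> closed_segment (l N - l i) (l N - l (Suc i))"
    then obtain z where z: "z \<in> closed_segment (l i) (l (Suc i))" "p = l N - z" using segdiff' by blast
    have iN: "i < N" using i by simp
    show "p / w \<notin> \<real>\<^sub>\<le>\<^sub>0"
    proof
      assume "p / w \<in> \<real>\<^sub>\<le>\<^sub>0"
      then obtain r where r: "r \<le> 0" "p / w = of_real r" by (auto elim: nonpos_Reals_cases)
      then have "p = r *\<^sub>R w" using uw by (simp add: field_simps scaleR_conv_of_real)
      then have "z - x = (rN - r) *\<^sub>R cis m"
        using z(2) lN(1) by (simp add: algebra_simps w_def)
      then have "norm (z - x) *\<^sub>R cis (\<theta> z) = (rN - r) *\<^sub>R cis m" using lx[OF iN z(1)] by simp
      moreover have "norm (z - x) > 0" using lx[OF iN z(1)] by simp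
      ultimately have "\<theta> z = m"
        using scaled_cis_eq_imp_eq[of "norm (z - x)" "\<theta> z" "rN - r" m] bnd[OF iN z(1)] r(1) lN(2) Mm al by auto
      then show False using bnd(4)[OF iN z(1)] i by simp
    qed
  qed (use uw in auto)
  have "(\<Sum>j\<in>{1..<N}. signed_angle (l j - l 0) (l (Suc j) - l 0)) = (\<Sum>j\<in>{1..<N}. B (Suc j) - B j)"
    using first by (intro sum.cong) auto
  also have "\<dots> = B N - B 1" using N by (intro sum_Suc_diff') auto
  finally have sum1: "(\<Sum>j\<in>{1..<N}. signed_angle (l j - l 0) (l (Suc j) - l 0)) = B N - B 1" .
  have "(\<Sum>i<N - 1. signed_angle (l N - l i) (l N - l (Suc i))) = (\<Sum>i<N - 1. E (Suc i) - E i)"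
    using second by (intro sum.cong) auto
  also have "\<dots> = E (N - 1) - E 0" by (rule sum_lessThan_telescope)
  finally have sum2: "(\<Sum>i<N - 1. signed_angle (l N - l i) (l N - l (Suc i))) = E (N - 1) - E 0" .
  have y: "l N - l 0 = rN *\<^sub>R w - r0 *\<^sub>R u" using l0(1) lN(1) by (simp add: algebra_simps)
  have glue: "B N = E 0 - \<alpha>"
  proof -
    \<comment> \<open>The secant \<open>l N - l 0\<close> divided by \<open>w\<close>; divided by
      \<open>- u\<close> it is \<open>a\<close> rotated by \<open>- \<alpha>\<close>. As
      \<open>Arg a\<close> is nonnegative and \<open>\<alpha> < pi\<close>, the rotation does not
      cross the cut of \<open>Arg\<close>.\<close>
    define a where "a = of_real rN + of_real r0 * cis \<alpha>"
    have cc: "cis (- \<alpha>) * cis \<alpha> = 1" by (simp add: cis_mult)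
    have "(l N - l 0) / (- u) = cis (- \<alpha>) * a"
      unfolding y w_eq a_def using uw cc
      by (simp add: divide_simps scaleR_conv_of_real ring_distribs)
    moreover have "(l N - l 0) / w = a"
    proof -
      have "a * w = of_real rN * w - of_real r0 * u * (cis (- \<alpha>) * cis \<alpha>)"
        unfolding a_def by (simp add: w_eq algebra_simps)
      then show ?thesis using uw cc unfolding y by (simp add: divide_eq_eq scaleR_conv_of_real)
    qed
    moreover have "a \<noteq> 0"
    proof
      assume "a = 0"
      then have "Im a = 0" "Re a = 0" by auto
      then have "sin \<alpha> = 0" "rN + r0 * cos \<alpha> = 0" using l0(2) by (auto simp: a_def)
      then have "\<alpha> = 0" using al sin_gt_zero[of \<alpha>] by fastforce
      then show False using \<open>rN + r0 * cos \<alpha> = 0\<close> l0(2) lN(2) by simp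
    qed
    moreover have "0 \<le> Im a" using al l0(2) by (simp add: a_def sin_ge_zero)
    then have "0 \<le> Arg a" using Arg_less_0 by simp
    moreover have "Arg (cis (- \<alpha>)) = - \<alpha>" using al by (intro Arg_cis) auto
    moreover have "cis (- \<alpha>) \<noteq> 0" by simp
    ultimately show ?thesis
      unfolding B_def E_def using Arg_le_pi[of a] al Arg_times[of "cis (- \<alpha>)" a] by auto
  qed
  have B1: "B 1 > 0"
  proof -
    have "\<theta> (l 1) < \<theta> (l 0)" using inner[of 1] N by auto
    then have "Im ((l 1 - x) / (l 0 - x)) < 0" using argument_on_segment_decreasing[OF seg[of 0]] N by simp
    moreover have "(l 1 - l 0) / (- u) = of_real r0 * (1 - (l 1 - x) / (l 0 - x))"
      using l0 uw by (simp add: field_simps scaleR_conv_of_real)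
    ultimately have "Im ((l 1 - l 0) / (- u)) > 0" using l0(2) by (simp add: mult_pos_neg)
    then show ?thesis unfolding B_def using Arg_lt_pi by blast
  qed
  have E1: "E (N - 1) < 0"
  proof -
    have Suc: "Suc (N - 1) = N" using N by simp
    have "\<theta> (l N) < \<theta> (l (N - 1))" using inner[of "N - 1"] N by auto
    then have "Im ((l (N - 1) - x) / (l N - x)) > 0"
      using argument_on_segment_decreasing[OF seg[of "N - 1"]] N Suc by simp
    moreover have "(l N - l (N - 1)) / w = of_real rN * (1 - (l (N - 1) - x) / (l N - x))"
      using lN uw by (simp add: field_simps scaleR_conv_of_real)
    ultimately have "Im ((l N - l (N - 1)) / w) < 0" using lN(2) by (simp add: mult_pos_neg)
    then show ?thesis unfolding E_def using Arg_neg_iff by blast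
  qed
  \<comment> \<open>The two sums add up to \<open>- \<alpha> - B 1 + E (N - 1)\<close>; strictness
    is due to the first and last edges, along which \<theta> decreases.\<close>
  show ?thesis
    using hopf_open[of N l, OF ne adj dis] sum1 sum2 glue B1 E1 by simp
qed

subsection \<open>The exterior of a simple polygon\<close>

lemma simple_cycle_arc:
  assumes v: "simple_cycle n v" and "0 < k" "k < n"
  shows "\<exists>g. arc g \<and> pathstart g = v 0 \<and> pathfinish g = v (int k) \<and> path_image g = (\<Union>i<k. side v (int i))"
  using assms(2,3)
proof (induction k)
  case (Suc k)
  have lin: "arc (linepath (v (int k)) (v (int k + 1)))"
    using simple_cycle_neq[OF v] by (intro arc_linepath)
  show ?case
  proof (cases "k = 0")
    case True
    then show ?thesis
      using lin by (intro exI[of _ "linepath (v 0) (v 1)"]) (auto simp: side_def)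
  next
    case False
    then obtain g where g: "arc g" "pathstart g = v 0" "pathfinish g = v (int k)"
      "path_image g = (\<Union>i<k. side v (int i))"
      using Suc by auto
    have "side v (int i) \<inter> side v (int k) \<subseteq> {v (int k)}" if "i < k" for i
    proof (cases "Suc i = k")
      case True
      then have "int k = int i + 1" by auto
      then show ?thesis using simple_cycle_adj[OF v, of "int i"] by simp
    next
      case False
      then show ?thesis
        using simple_cycle_disjoint[OF v, of "int i" "int k"] that Suc.prems by auto
    qed
    then have "path_image g \<inter> path_image (linepath (v (int k)) (v (int k + 1))) \<subseteq> {v (int k)}"
      unfolding g(4) by (auto simp: side_def)
    then have "arc (g +++ linepath (v (int k)) (v (int k + 1)))"
      using g lin by (intro arc_join) auto
    moreover have "path_image (g +++ linepath (v (int k)) (v (int k + 1))) = (\<Union>i<Suc k. side v (int i))"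
      using g by (subst path_image_join) (auto simp: side_def lessThan_Suc)
    ultimately show ?thesis using g
      by (intro exI[of _ "g +++ linepath (v (int k)) (v (int k + 1))"]) (auto simp: add.commute)
  qed
qed simp

text \<open>The parametrisation needed for the Jordan curve theorem: the last side closes the arc
  formed by the others, meeting it in its end points.\<close>

lemma simple_cycle_simple_path:
  assumes v: "simple_cycle n v"
  obtains g where "simple_path g" "pathfinish g = pathstart g" "path_image g = polyline_set (cycle_list n v)"
proof -
  define k where "k = n - 1"
  have k: "0 < k" "k < n" "n = Suc k" "2 \<le> k" using simple_cycle_ge3[OF v] by (auto simp: k_def)
  have v0: "v (int k + 1) = v 0" using simple_cycle_periodic[OF v, of 0] k(3) by (simp add: add.commute)
  obtain g where g: "arc g" "pathstart g = v 0" "pathfinish g = v (int k)"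
    "path_image g = (\<Union>i<k. side v (int i))"
    using simple_cycle_arc[OF v k(1,2)] by auto
  define h where "h = linepath (v (int k)) (v (int k + 1))"
  have h: "arc h" "path_image h = side v (int k)" "pathstart h = v (int k)" "pathfinish h = v 0"
    using simple_cycle_neq[OF v, of "int k"] v0 unfolding h_def by (auto simp: side_def intro!: arc_linepath)
  have "side v (int i) \<inter> side v (int k) \<subseteq> {v 0, v (int k)}" if "i < k" for i
  proof -
    consider "Suc i = k" | "i = 0" | "0 < i" "Suc i < k" using \<open>i < k\<close> by linarith
    then show ?thesis
    proof cases
      case 1
      then have "int k = int i + 1" by auto
      then show ?thesis using simple_cycle_adj[OF v, of "int i"] by simp
    next
      case 2
      have "side v (int k + 1) = side v 0"
        using simple_cycle_side_mod[OF v, of "int n"] k(3) by (simp add: add.commute)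
      then show ?thesis using simple_cycle_adj[OF v, of "int k"] v0 2 by auto
    next
      case 3
      then show ?thesis using simple_cycle_disjoint[OF v, of "int i" "int k"] k by auto
    qed
  qed
  then have "path_image g \<inter> path_image h \<subseteq> {pathstart g, pathstart h}"
    unfolding g h by auto
  then have "simple_path (g +++ h)" using g h by (intro simple_path_join_loop) auto
  moreover have "path_image (g +++ h) = polyline_set (cycle_list n v)"
  proof -
    have "path_image (g +++ h) = (\<Union>i<n. side v (int i))"
      using g h k(3) by (subst path_image_join) (auto simp: lessThan_Suc)
    then show ?thesis by (simp add: polyline_set_def edge_cycle_list)
  qed
  ultimately show ?thesis using that[of "g +++ h"] g h by simp
qed

text \<open>\<open>bounds_polygon\<close> only asks for some bounded component \<open>C\<close>. By
  the Jordan curve theorem the inside is connected, so \<open>C\<close> is all of it and a point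
  outside \<open>K\<close> cannot lie there.\<close>

lemma exterior_component_unbounded:
  assumes K: "bounds_polygon (cycle_list n v) K" and v: "simple_cycle n v" and x: "x \<notin> K"
  shows "\<not> bounded (connected_component_set (- polyline_set (cycle_list n v)) x)"
proof
  define S where "S = polyline_set (cycle_list n v)"
  assume bd: "bounded (connected_component_set (- polyline_set (cycle_list n v)) x)"
  obtain C where C: "C \<in> components (- S)" "bounded C" "K = S \<union> C"
    using K by (auto simp: bounds_polygon_def S_def)
  obtain g where "simple_path g" "pathfinish g = pathstart g" "path_image g = S"
    using simple_cycle_simple_path[OF v] by (auto simp: S_def)
  then have conn: "connected (inside S)" using Jordan_inside_outside by blast
  have "x \<in> inside S" using bd x C(3) by (auto simp: inside_def S_def)
  moreover obtain y where y: "y \<in> - S" "C = connected_component_set (- S) y"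
    using C(1) by (auto simp: components_def)
  then have "y \<in> inside S" "y \<in> C" using C(2) by (auto simp: inside_def)
  moreover have "inside S \<subseteq> - S" using inside_no_overlap by blast
  ultimately have "x \<in> C" using components_maximal[OF C(1) conn] by blast
  then show False using x C(3) by blast
qed

lemma compact_polyline_set: "compact (polyline_set vs)"
  unfolding polyline_set_def edge_def by (intro compact_UN) auto

text \<open>By Borsuk's criterion the radial projection from \<open>x\<close> onto the circle is
  null-homotopic on the boundary once the component of \<open>x\<close> is unbounded, and a
  null-homotopic map into the circle has a continuous logarithm.\<close>

lemma exterior_argument_exists:
  assumes K: "bounds_polygon (cycle_list n v) K" and v: "simple_cycle n v" and x: "x \<notin> K"
  obtains \<theta> where "argument_on (polyline_set (cycle_list n v)) x \<theta>"
proof -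
  define S where "S = polyline_set (cycle_list n v)"
  have xS: "x \<notin> S" using K x by (auto simp: bounds_polygon_def S_def)
  have "\<exists>c. homotopic_with_canon (\<lambda>x. True) S (sphere 0 1)
      (\<lambda>y. inverse (norm (y - x)) *\<^sub>R (y - x)) (\<lambda>y. c)"
    using exterior_component_unbounded[OF assms] xS
      Borsuk_map_essential_bounded_component[OF compact_polyline_set, of x "cycle_list n v"]
    by (simp add: S_def)
  then obtain \<theta> where \<theta>: "continuous_on S \<theta>"
    "\<forall>y\<in>S. inverse (norm (y - x)) *\<^sub>R (y - x) = exp (\<i> * of_real (\<theta> y))"
    unfolding inessential_eq_continuous_logarithm_circle by auto
  have "y - x = norm (y - x) *\<^sub>R cis (\<theta> y)" if "y \<in> S" for y
  proof -
    have "norm (y - x) *\<^sub>R (inverse (norm (y - x)) *\<^sub>R (y - x)) = norm (y - x) *\<^sub>R cis (\<theta> y)"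
      using \<theta>(2) that by (simp add: cis_conv_exp)
    then show ?thesis using xS that by (cases "y = x") auto
  qed
  then have "argument_on S x \<theta>" using xS \<theta>(1) by (auto simp: argument_on_def)
  then show ?thesis using that by (simp add: S_def)
qed

subsection \<open>The boundary seen from an exterior point\<close>

lemma argument_variation_less:
  assumes v: "simple_cycle n v" and arg: "argument_on (polyline_set (cycle_list n v)) x \<theta>"
    and aco: "aco_boundary (cycle_list n v) > - pi"
  shows "\<theta> (v i) - \<theta> (v j) < pi - aco_boundary (cycle_list n v)"
proof (rule ccontr)
  assume not: "\<not> ?thesis"
  define \<alpha> where "\<alpha> = - aco_boundary (cycle_list n v)"
  have al: "0 \<le> \<alpha>" "\<alpha> < pi" using aco aco_boundary_nonpos[OF v] by (auto simp: \<alpha>_def)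
  have n3: "3 \<le> n" by (rule simple_cycle_ge3[OF v])
  have S: "polyline_set (cycle_list n v) = (\<Union>i. side v i)" by (rule polyline_set_cycle_list[OF v])
  have sides: "argument_on (side v i) x \<theta>" for i
    using argument_on_subset[OF arg] unfolding S by (simp add: UN_upper)
  \<comment> \<open>The least number of sides is taken over all starting vertices, so no shorter run
    of sides anywhere has such a drop.\<close>
  define N where "N = (LEAST N. \<exists>i. \<theta> (v i) - \<theta> (v (i + int N)) \<ge> pi + \<alpha>)"
  \<comment> \<open>The number of sides walked forward from \<open>v i\<close> to
    \<open>v j\<close>. It bounds \<open>N\<close> below a full turn.\<close>
  define d where "d = nat ((j - i) mod int n)"
  have d: "d < n" "v (i + int d) = v j"
  proof -
    show "d < n" using n3 by (simp add: d_def nat_less_iff)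
    have "(i + (j - i) mod int n) mod int n = j mod int n" by (simp add: mod_simps)
    then show "v (i + int d) = v j"
      using simple_cycle_mod[OF v, of "i + (j - i) mod int n"] simple_cycle_mod[OF v, of j] n3
      by (simp add: d_def)
  qed
  have dd: "\<exists>i. \<theta> (v i) - \<theta> (v (i + int d)) \<ge> pi + \<alpha>"
    using not d by (intro exI[of _ i]) (simp add: \<alpha>_def)
  then have "\<exists>i. \<theta> (v i) - \<theta> (v (i + int N)) \<ge> pi + \<alpha>" unfolding N_def by (rule LeastI)
  then obtain a where a: "\<theta> (v a) - \<theta> (v (a + int N)) \<ge> pi + \<alpha>" by blast
  have "N \<le> d" unfolding N_def using dd by (rule Least_le)
  then have Nn: "N < n" using d by simp
  have small: "\<theta> (v b) - \<theta> (v (b + int k)) < pi + \<alpha>" if "k < N" for b k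
    using not_less_Least[of k "\<lambda>N. \<exists>i. \<theta> (v i) - \<theta> (v (i + int N)) \<ge> pi + \<alpha>"] that
    unfolding N_def[symmetric] by (auto simp: not_le)
  \<comment> \<open>A segment is seen under an angle less than \<pi>, so the drop takes at least two
    sides.\<close>
  have edge_small: "\<theta> (v b) - \<theta> (v (b + 1)) < pi" for b
    using argument_on_segment_lt_pi[of "v b" "v (b + 1)" x \<theta>] sides[of b] by (auto simp: side_def)
  have "N \<noteq> 0"
  proof
    assume "N = 0"
    then show False using a al pi_gt_zero by simp
  qed
  moreover have "N \<noteq> 1"
  proof
    assume "N = 1"
    then show False using a edge_small[of a] al by simp
  qed
  ultimately have N2: "2 \<le> N" by simp
  define b where "b = a + int (N - 1)"
  have b: "b + 1 = a + int N" using N2 by (simp add: b_def)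
  \<comment> \<open>The drop may overshoot at the last vertex; the last side is therefore cut at a
    point where \<theta> is exactly \<open>pi + \<alpha>\<close> below its initial value.\<close>
  define T where "T = \<theta> (v a) - (pi + \<alpha>)"
  have Tb: "T < \<theta> (v b)" "\<theta> (v (b + 1)) \<le> T"
    using small[of "N - 1" a] a N2 unfolding T_def b b_def[symmetric] by auto
  have "\<exists>z\<in>side v b. \<theta> z = T"
  proof -
    have "connected (\<theta> ` side v b)"
      using sides[of b] by (intro connected_continuous_image) (auto simp: argument_on_def side_def)
    moreover have "\<theta> (v b) \<in> \<theta> ` side v b" "\<theta> (v (b + 1)) \<in> \<theta> ` side v b" by (auto simp: side_def)
    ultimately have "T \<in> \<theta> ` side v b"
      using Tb unfolding connected_iff_interval by (meson less_imp_le)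
    then show ?thesis by auto
  qed
  then obtain z where z: "z \<in> side v b" "\<theta> z = T" by blast
  have zb: "z \<noteq> v b" using z Tb by auto
  obtain s where s: "0 \<le> s" "s \<le> 1" "z = (1 - s) *\<^sub>R v b + s *\<^sub>R v (b + 1)"
    using z(1) unfolding side_def in_segment by auto
  have s0: "s > 0" using s zb by (cases "s = 0") auto
  have zdir: "z - v b = s *\<^sub>R side_shift v b" using s(3) by (simp add: side_shift_def algebra_simps)
  define l where "l k = (if k < N then v (a + int k) else z)" for k
  have lk: "l k = v (a + int k)" if "k < N" for k using that by (simp add: l_def)
  have lN: "l N = z" "l 0 = v a" using N2 by (auto simp: l_def)
  have sub: "closed_segment (l k) (l (Suc k)) \<subseteq> side v (a + int k)" if "k < N" for k
  proof (cases "Suc k = N")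
    case True
    then have "a + int k = b" by (simp add: b_def)
    then show ?thesis using lk[OF that] True lN(1) z(1) unfolding side_def
      by (simp add: subset_closed_segment)
  next
    case False
    then show ?thesis using that by (simp add: lk side_def add.commute add.left_commute)
  qed
  have joint: "l (Suc k) = v (a + int k + 1)" if "Suc k < N" for k
    using that by (simp add: lk algebra_simps)
  have dir: "\<exists>\<alpha>>0. l (Suc k) - l k = \<alpha> *\<^sub>R side_shift v (a + int k)" if "k < N" for k
  proof (cases "Suc k = N")
    case True
    then have "a + int k = b" by (simp add: b_def)
    then show ?thesis using lk[OF that] True lN(1) zdir s0 by auto
  next
    case False
    then have "Suc k < N" using that by simp
    then show ?thesis using joint lk[OF that] by (intro exI[of _ 1]) (simp add: side_shift_def)
  qed
  have "aco_boundary (cycle_list n v) \<le>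
      (\<Sum>k<N - 1. signed_angle (l (Suc k) - l k) (l (Suc (Suc k)) - l (Suc k)))"
    using N2 Nn sub joint dir by (intro aco_boundary_le_rot_chain[OF v]) auto
  moreover have "(\<Sum>k<N - 1. signed_angle (l (Suc k) - l k) (l (Suc (Suc k)) - l (Suc k))) < - \<alpha>"
  proof (rule rot_clockwise_sector)
    show "l k \<noteq> l (Suc k)" if "k < N" for k
      using dir[OF that] simple_cycle_neq[OF v, of "a + int k"] by (auto simp: side_shift_def)
    show "closed_segment (l k) (l (Suc k)) \<inter> closed_segment (l (Suc k)) (l (Suc (Suc k))) = {l (Suc k)}"
      if "Suc k < N" for k
    proof -
      have "closed_segment (l k) (l (Suc k)) \<inter> closed_segment (l (Suc k)) (l (Suc (Suc k)))
          \<subseteq> side v (a + int k) \<inter> side v (a + int k + 1)"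
        using sub[of k] sub[of "Suc k"] that by (auto simp: algebra_simps)
      also have "\<dots> = {l (Suc k)}" using simple_cycle_adj[OF v] joint[OF that] by simp
      finally show ?thesis by auto
    qed
    show "closed_segment (l k) (l (Suc k)) \<inter> closed_segment (l m) (l (Suc m)) = {}"
      if "Suc k < m" "m < N" for k m
    proof -
      have "side v (a + int k) \<inter> side v (a + int m) = {}"
        using that Nn by (intro simple_cycle_disjoint[OF v]) auto
      then show ?thesis using sub[of k] sub[of m] that by auto
    qed
    show "2 \<le> N" by (rule N2)
    have "(\<Union>k<N. closed_segment (l k) (l (Suc k))) \<subseteq> (\<Union>i. side v i)"
      using sub by fastforce
    then show "argument_on (\<Union>k<N. closed_segment (l k) (l (Suc k))) x \<theta>"
      using argument_on_subset[OF arg] unfolding S by blast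
    show "0 \<le> \<alpha>" "\<alpha> < pi" by (rule al)+
    show "\<theta> (l N) = \<theta> (l 0) - (pi + \<alpha>)" using lN z(2) by (simp add: T_def)
    \<comment> \<open>Minimality is used twice: the run before \<open>l k\<close> drops too little
      to reach \<open>T\<close>, and the run after it drops too little for \<theta> to start at or
      above its value at \<open>l 0\<close>.\<close>
    show "\<theta> (l N) < \<theta> (l k) \<and> \<theta> (l k) < \<theta> (l 0)" if "0 < k" "k < N" for k
    proof
      show "\<theta> (l N) < \<theta> (l k)" using small[of k a] that lN lk[of k] z(2) by (simp add: T_def)
      have "\<theta> (v (a + int k)) - \<theta> (v (a + int k + int (N - k))) < pi + \<alpha>"
        using that by (intro small) auto
      moreover have "a + int k + int (N - k) = a + int N" using that by simp
      ultimately show "\<theta> (l k) < \<theta> (l 0)" using a that lN lk[of k] by simp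
    qed
  qed
  ultimately show False by (simp add: \<alpha>_def)
qed

text \<open>For a unit vector \<open>e\<close> and \<open>c\<close> at most 1 these are the
  directions within \<open>arccos c\<close> of \<open>e\<close>. Convexity is the triangle
  inequality, multiplied by a nonnegative \<open>c\<close>.\<close>

lemma convex_cone_around:
  fixes e x :: complex
  assumes "0 \<le> c"
  shows "convex {y. c * norm (y - x) \<le> (y - x) \<bullet> e}"
proof (rule convexI)
  fix p q :: complex and s t :: real
  assume p: "p \<in> {y. c * norm (y - x) \<le> (y - x) \<bullet> e}" and q: "q \<in> {y. c * norm (y - x) \<le> (y - x) \<bullet> e}"
    and st: "0 \<le> s" "0 \<le> t" "s + t = 1"
  have eq: "s *\<^sub>R p + t *\<^sub>R q - x = s *\<^sub>R (p - x) + t *\<^sub>R (q - x)"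
  proof -
    have "x = (s + t) *\<^sub>R x" using st by simp
    then show ?thesis by (simp add: algebra_simps)
  qed
  have "c * norm (s *\<^sub>R (p - x) + t *\<^sub>R (q - x)) \<le> c * (s * norm (p - x) + t * norm (q - x))"
    using assms st norm_triangle_ineq[of "s *\<^sub>R (p - x)" "t *\<^sub>R (q - x)"]
    by (intro mult_left_mono) auto
  also have "\<dots> = s * (c * norm (p - x)) + t * (c * norm (q - x))" by (simp add: algebra_simps)
  also have "\<dots> \<le> s * ((p - x) \<bullet> e) + t * ((q - x) \<bullet> e)"
    using p q st by (intro add_mono mult_left_mono) auto
  also have "\<dots> = (s *\<^sub>R (p - x) + t *\<^sub>R (q - x)) \<bullet> e" by (simp add: inner_add_left)
  finally show "s *\<^sub>R p + t *\<^sub>R q \<in> {y. c * norm (y - x) \<le> (y - x) \<bullet> e}"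
    unfolding mem_Collect_eq eq .
qed

lemma cis_inner: "cis a \<bullet> cis b = cos (a - b)"
  by (simp add: inner_complex_def cos_diff)

text \<open>The rays at angles \<open>c - \<beta> / 2\<close> and \<open>c + \<beta> / 2\<close> lie
  in the cone of half-angle \<open>\<beta> / 2\<close> about \<open>cis c\<close>, hence so does
  their convex hull. The ray inside \<open>A\<close> serves to show that \<open>A\<close> is
  unbounded, its convexity that it is connected.\<close>

lemma angular_region_in_cone:
  assumes b: "0 < \<beta>" "\<beta> \<le> pi"
  obtains A u where "angular_region A x \<beta>" "u \<noteq> 0" "ray x u \<subseteq> A" "convex A"
    "A \<subseteq> {y. cos (\<beta> / 2) * norm (y - x) \<le> (y - x) \<bullet> cis c}"
proof (cases "\<beta> = pi")
  case True
  define A where "A = {y. 0 \<le> cis c \<bullet> (y - x)}"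
  have "angular_region A x \<beta>" unfolding angular_region_def A_def using True cis_neq_zero by blast
  moreover have "A = {y. cos (\<beta> / 2) * norm (y - x) \<le> (y - x) \<bullet> cis c}"
    by (simp add: A_def True inner_commute)
  moreover have "ray x (cis c) \<subseteq> A" by (auto simp: ray_def A_def)
  moreover have "convex A" using calculation(2) True convex_cone_around[of 0 x "cis c"] by simp
  ultimately show ?thesis using that[of A "cis c"] by auto
next
  case False
  then have b': "\<beta> < pi" using b by simp
  have cb: "cos (\<beta> / 2) > 0" using b b' by (intro cos_gt_zero) auto
  define v where "v = cis (c - \<beta> / 2)"
  define w where "w = cis (c + \<beta> / 2)"
  have ve: "v \<bullet> cis c = cos (\<beta> / 2)" "w \<bullet> cis c = cos (\<beta> / 2)"
    by (auto simp: v_def w_def cis_inner)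
  have nz: "v \<noteq> 0" "w \<noteq> 0" "norm v = 1" "norm w = 1" by (auto simp: v_def w_def)
  have "0 \<notin> closed_segment v w"
  proof
    assume "0 \<in> closed_segment v w"
    then obtain t where t: "0 \<le> t" "t \<le> 1" "0 = (1 - t) *\<^sub>R v + t *\<^sub>R w" unfolding in_segment by auto
    then have "0 = ((1 - t) *\<^sub>R v + t *\<^sub>R w) \<bullet> cis c" by simp
    also have "\<dots> = cos (\<beta> / 2)" using ve by (simp add: inner_add_left algebra_simps)
    finally show False using cb by simp
  qed
  moreover have "w / v = cis \<beta>" by (simp add: v_def w_def cis_divide)
  ultimately have ang: "signed_angle v w = \<beta>"
    using b by (simp add: signed_angle_eq_Arg Arg_cis)
  have "\<not> opposite v w"
  proof
    assume "opposite v w"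
    then obtain k where k: "k < 0" "v = k *\<^sub>R w" by (auto simp: opposite_def)
    then have "v \<bullet> cis c = k * (w \<bullet> cis c)" by simp
    then show False using ve cb k(1) by (simp add: mult_neg_pos)
  qed
  define A where "A = convex hull (ray x v \<union> ray x w)"
  have "angular_region A x \<beta>"
    unfolding angular_region_def A_def using nz \<open>\<not> opposite v w\<close> ang b
    by (intro disjI1 exI[of _ v] exI[of _ w]) auto
  moreover have "ray x v \<subseteq> A" unfolding A_def using hull_subset[of "ray x v \<union> ray x w" convex] by blast
  moreover have "A \<subseteq> {y. cos (\<beta> / 2) * norm (y - x) \<le> (y - x) \<bullet> cis c}"
    unfolding A_def
  proof (rule hull_minimal)
    show "ray x v \<union> ray x w \<subseteq> {y. cos (\<beta> / 2) * norm (y - x) \<le> (y - x) \<bullet> cis c}"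
      using ve nz by (auto simp: ray_def)
    show "convex {y. cos (\<beta> / 2) * norm (y - x) \<le> (y - x) \<bullet> cis c}"
      using cb by (intro convex_cone_around) simp
  qed
  moreover have "convex A" by (simp add: A_def)
  ultimately show ?thesis using that nz by blast
qed

lemma unbounded_ray:
  assumes "u \<noteq> 0" "ray x u \<subseteq> A"
  shows "\<not> bounded A"
proof
  assume "bounded A"
  then have "bounded (ray x u)" using assms(2) bounded_subset by blast
  then obtain r where r: "\<And>y. y \<in> ray x u \<Longrightarrow> norm y \<le> r" unfolding bounded_iff by blast
  define t where "t = (\<bar>r\<bar> + norm x + 1) / norm u"
  have "t \<ge> 0" by (simp add: t_def)
  then have "norm (x + t *\<^sub>R u) \<le> r" by (intro r) (auto simp: ray_def)
  moreover have "norm (t *\<^sub>R u) = \<bar>r\<bar> + norm x + 1" using assms(1) by (simp add: t_def)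
  moreover have "norm (t *\<^sub>R u) \<le> norm (x + t *\<^sub>R u) + norm x"
    using norm_triangle_ineq4[of "x + t *\<^sub>R u" x] by simp
  ultimately show False by linarith
qed

lemma angular_region_avoids_polygon:
  assumes v: "simple_cycle n v" and K: "bounds_polygon (cycle_list n v) K"
    and aco: "aco_boundary (cycle_list n v) > - pi" and x: "x \<notin> K"
  shows "\<exists>A. angular_region A x (pi + aco_boundary (cycle_list n v)) \<and> A \<inter> K = {}"
proof -
  define S where "S = polyline_set (cycle_list n v)"
  have Sv: "S = (\<Union>i. side v i)" unfolding S_def by (rule polyline_set_cycle_list[OF v])
  obtain \<theta> where \<theta>: "argument_on S x \<theta>" using exterior_argument_exists[OF K v x] by (auto simp: S_def)
  define \<alpha> where "\<alpha> = - aco_boundary (cycle_list n v)"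
  have al: "0 \<le> \<alpha>" "\<alpha> < pi" using aco aco_boundary_nonpos[OF v] by (auto simp: \<alpha>_def)
  have n3: "3 \<le> n" by (rule simple_cycle_ge3[OF v])
  define V where "V = (\<lambda>i. \<theta> (v i)) ` {0..<int n}"
  have V: "finite V" "V \<noteq> {}" using n3 by (auto simp: V_def)
  have inV: "\<theta> (v i) \<in> V" for i
  proof -
    have "\<theta> (v (i mod int n)) \<in> V" unfolding V_def using n3 by (intro imageI) auto
    then show ?thesis by (simp add: simple_cycle_mod[OF v])
  qed
  have "Max V \<in> V" "Min V \<in> V" using V by auto
  then have range: "Max V - Min V < pi + \<alpha>"
    using argument_variation_less[OF v \<theta>[unfolded S_def] aco] by (auto simp: V_def \<alpha>_def)
  have bnd: "Min V \<le> \<theta> z \<and> \<theta> z \<le> Max V" if "z \<in> S" for z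
  proof -
    obtain i where i: "z \<in> side v i" using \<open>z \<in> S\<close> unfolding Sv by auto
    have "argument_on (closed_segment (v i) (v (i + 1))) x \<theta>"
      by (rule argument_on_subset[OF \<theta>]) (auto simp: Sv side_def)
    then have "\<theta> z \<le> max (\<theta> (v i)) (\<theta> (v (i + 1))) \<and> min (\<theta> (v i)) (\<theta> (v (i + 1))) \<le> \<theta> z"
      using argument_on_segment_le i unfolding side_def by blast
    moreover have "Min V \<le> \<theta> (v k)" "\<theta> (v k) \<le> Max V" for k using V inV by auto
    ultimately show ?thesis by (auto simp: max_def min_def split: if_splits intro: order_trans)
  qed
  define \<beta> where "\<beta> = pi - \<alpha>"
  \<comment> \<open>The axis of the region points away from the middle of the range of
    \<theta>.\<close>
  define c where "c = (Max V + Min V) / 2 + pi"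
  have \<beta>: "0 < \<beta>" "\<beta> \<le> pi" using al by (auto simp: \<beta>_def)
  obtain A u where A: "angular_region A x \<beta>" "u \<noteq> 0" "ray x u \<subseteq> A" "convex A"
    and cone: "A \<subseteq> {y. cos (\<beta> / 2) * norm (y - x) \<le> (y - x) \<bullet> cis c}"
    using angular_region_in_cone[OF \<beta>] by metis
  have AS: "A \<inter> S = {}"
  proof (rule ccontr)
    assume "A \<inter> S \<noteq> {}"
    then obtain z where z: "z \<in> A" "z \<in> S" by auto
    have zx: "z - x = norm (z - x) *\<^sub>R cis (\<theta> z)" "z \<noteq> x"
      using \<theta> z(2) by (auto simp: argument_on_def)
    have "(z - x) \<bullet> cis c = norm (z - x) * cos (\<theta> z - c)"
      by (subst zx(1)) (simp add: cis_inner)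
    also have "cos (\<theta> z - c) = - cos (\<theta> z - (Max V + Min V) / 2)"
    proof -
      have "\<theta> z - c = \<theta> z - (Max V + Min V) / 2 - pi" by (simp add: c_def)
      then show ?thesis by (simp only: cos_diff cos_pi sin_pi) simp
    qed
    also have "cos (\<theta> z - (Max V + Min V) / 2) = cos \<bar>\<theta> z - (Max V + Min V) / 2\<bar>" by simp
    finally have in1: "(z - x) \<bullet> cis c = - (norm (z - x) * cos \<bar>\<theta> z - (Max V + Min V) / 2\<bar>)" by simp
    \<comment> \<open>A boundary point deviates from the middle direction by less than
      \<open>(pi + \<alpha>) / 2\<close>, which is \<open>pi - \<beta> / 2\<close>, so it makes an
      angle greater than \<open>\<beta> / 2\<close> with the opposite axis.\<close>
    have "\<bar>\<theta> z - (Max V + Min V) / 2\<bar> < (pi + \<alpha>) / 2" using bnd[OF z(2)] range by (auto simp: abs_if field_simps)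
    then have "cos ((pi + \<alpha>) / 2) < cos \<bar>\<theta> z - (Max V + Min V) / 2\<bar>"
      using al by (intro cos_monotone_0_pi) auto
    moreover have "cos ((pi + \<alpha>) / 2) = - cos (\<beta> / 2)"
    proof -
      have "(pi + \<alpha>) / 2 = pi - \<beta> / 2" by (simp add: \<beta>_def field_simps)
      then show ?thesis by (simp only: cos_diff cos_pi sin_pi)
    qed
    ultimately have "- cos (\<beta> / 2) < cos \<bar>\<theta> z - (Max V + Min V) / 2\<bar>" by simp
    then have "norm (z - x) * (- cos (\<beta> / 2)) < norm (z - x) * cos \<bar>\<theta> z - (Max V + Min V) / 2\<bar>"
      using zx(2) by (intro mult_strict_left_mono) auto
    then have "(z - x) \<bullet> cis c < cos (\<beta> / 2) * norm (z - x)" using in1 by (simp add: mult.commute)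
    then show False using cone z(1) by auto
  qed
  obtain C where C: "C \<in> components (- S)" "bounded C" "K = S \<union> C"
    using K by (auto simp: bounds_polygon_def S_def)
  \<comment> \<open>Being connected and disjoint from the boundary, \<open>A\<close> would lie
    inside the bounded component as soon as it met it; but \<open>A\<close> contains a ray.\<close>
  have "A \<inter> C = {}"
  proof (rule ccontr)
    assume "A \<inter> C \<noteq> {}"
    then have "A \<subseteq> C"
      using components_maximal[OF C(1) convex_connected[OF A(4)]] AS by blast
    then show False using unbounded_ray[OF A(2,3)] C(2) bounded_subset by blast
  qed
  then have "A \<inter> K = {}" using AS C(3) by blast
  moreover have "\<beta> = pi + aco_boundary (cycle_list n v)" by (simp add: \<beta>_def \<alpha>_def)
  ultimately show ?thesis using A(1) by auto
qed

theorem theorem2: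
  fixes K :: "complex set"
  assumes "simple_polygon K"
    and "aco K > - pi"
  shows "\<forall>x. x \<notin> K \<longrightarrow> (\<exists>A. angular_region A x (pi + aco K) \<and> A \<inter> K = {})"
proof -
  define P where "P = (SOME P. bounds_polygon P K \<and> closed_rot P = 2 * pi)"
  have "bounds_polygon P K \<and> closed_rot P = 2 * pi"
    unfolding P_def by (rule someI_ex[OF counterclockwise_boundary_exists[OF assms(1)]])
  then have P: "bounds_polygon P K" by simp
  then obtain n v where "simple_cycle n v" "P = cycle_list n v"
    using simple_cycle_of_list by (metis bounds_polygon_def)
  moreover have "aco K = aco_boundary P" by (simp add: aco_def P_def)
  ultimately show ?thesis using angular_region_avoids_polygon[of n v K] P assms(2) by auto
qed

end
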